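(* Let $\alpha$ be an irrational real number with Diophantine type $\beta=\beta(\alpha)$, and let $\varphi:\mathbb N\to\mathbb R^+$ be a function decreasing to zero. Then $$\min\left\{u_\varphi,\ \max\left\{l_\varphi,\ \frac{1+u_\varphi}{1+\beta}\right\}\right\}\ \le\ \dim_H\big(E_\varphi(\alpha)\big)\ \le\ u_\varphi .$$
   Context: $\|x\|$ denotes the distance from $x\in\mathbb R$ to the nearest integer, $\mathbb N$ is the set of positive integers, $\mathbb R^+$ the set of positive reals, and $\dim_H$ is Hausdorff dimension. "Decreasing" is understood in the weak sense (non-increasing). The Diophantine type of an irrational $\alpha$ is $\beta(\alpha):=\sup\{\theta\ge 1:\liminf_{n\to\infty} n^\theta\|n\alpha\|=0\}\in[1,\infty]$ (equal to $1$ if the set is empty; if $\beta=\infty$, a quotient with denominator $1+\beta$ is read as $0$). For $\varphi:\mathbb N\to\mathbb R^+$ decreasing to zero, $$E_\varphi(\alpha):=\{y\in\mathbb R:\ \|n\alpha-y\|<\varphi(n)\text{ for infinitely many } n\in\mathbb N\},$$ $$u_\varphi:=\limsup_{n\to\infty}\frac{\log n}{-\log\varphi(n)},\qquad l_\varphi:=\liminf_{n\to\infty}\frac{\log n}{-\log\varphi(n)}.$$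
   Formalization: The lower bound is capped at 1, i.e. min{1, u_φ, max{l_φ, (1+u_φ)/(1+β)}}, since as printed it fails when it exceeds 1: for φ(n)=n^{-1/3} it equals 3, while a subset of ℝ has dimension at most 1. *)

theory Defs
  imports "HOL-Analysis.Analysis"
begin

section \<open>Hausdorff measure and dimension\<close>

text \<open>
  The term contributed by one set of a cover to the \<open>s\<close>-dimensional Hausdorff sum. The usual
  convention for \<open>s = 0\<close> (a nonempty set contributes 1, the empty set 0) has to be
  spelled out, because \<^term>\<open>0 powr 0 = (0::real)\<close>.
\<close>

definition hausdorff_gauge :: "real \<Rightarrow> 'a::metric_space set \<Rightarrow> real" where
  "hausdorff_gauge s U =
     (if U = {} then 0 else if s = 0 then 1 else diameter U powr s)"

text \<open>
  Covers are countable; finite covers are included by padding with empty sets. Boundedness is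
  required explicitly because \<^const>\<open>diameter\<close> is a real number, unspecified on unbounded sets.
\<close>

definition hausdorff_content :: "real \<Rightarrow> real \<Rightarrow> 'a::metric_space set \<Rightarrow> ennreal" where
  "hausdorff_content s \<delta> A =
     (INF U \<in> {U :: nat \<Rightarrow> 'a set. A \<subseteq> (\<Union>i. U i) \<and> (\<forall>i. bounded (U i) \<and> diameter (U i) \<le> \<delta>)}.
        \<Sum>i. ennreal (hausdorff_gauge s (U i)))"

definition hausdorff_measure :: "real \<Rightarrow> 'a::metric_space set \<Rightarrow> ennreal" where
  "hausdorff_measure s A = (SUP \<delta> \<in> {0<..}. hausdorff_content s \<delta> A)"

definition hausdorff_dim :: "'a::metric_space set \<Rightarrow> ereal" where
  "hausdorff_dim A = Inf {ereal s | s. 0 \<le> s \<and> hausdorff_measure s A = 0}"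


section \<open>Inhomogeneous Diophantine approximation\<close>

definition dist_int :: "real \<Rightarrow> real" where
  "dist_int x = infdist x \<int>"

text \<open>
  Inserting 1 only matters when the set is empty, where it yields the conventional value 1.
\<close>

definition diophantine_type :: "real \<Rightarrow> ereal" where
  "diophantine_type \<alpha> =
     Sup (insert 1 {ereal \<theta> | \<theta>. 1 \<le> \<theta> \<and>
       liminf (\<lambda>n. ereal (real n powr \<theta> * dist_int (real n * \<alpha>))) = 0})"

text \<open>
  Error functions live on the positive integers; the value at 0 has no influence below.
\<close>

definition inhom_approx_set :: "(nat \<Rightarrow> real) \<Rightarrow> real \<Rightarrow> real set" where
  "inhom_approx_set \<phi> \<alpha> = {y. infinite {n. 1 \<le> n \<and> dist_int (real n * \<alpha> - y) < \<phi> n}}"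

definition upper_order :: "(nat \<Rightarrow> real) \<Rightarrow> ereal" where
  "upper_order \<phi> = limsup (\<lambda>n. ereal (ln (real n) / (- ln (\<phi> n))))"

definition lower_order :: "(nat \<Rightarrow> real) \<Rightarrow> ereal" where
  "lower_order \<phi> = liminf (\<lambda>n. ereal (ln (real n) / (- ln (\<phi> n))))"

text \<open>
  Both orders may exceed 1, whereas no subset of the line has dimension above 1: for
  \<open>\<phi> n = n powr (- 1 / 3)\<close> both orders are 3. A lower bound for a dimension in terms of the
  orders therefore has to be capped at 1. The cap is redundant if \<open>upper_order \<phi> \<le> 1\<close>.

  In \<^typ>\<open>ereal\<close>, \<open>x / \<infinity> = 0\<close> for every \<open>x\<close>, including \<open>x = \<infinity>\<close>; so a quotient by
  \<open>1 + diophantine_type \<alpha>\<close> is 0 when the type is infinite.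
\<close>

end

theory Submission
  imports Defs
begin

text \<open>
  Write \<open>u\<close> and \<open>l\<close> for the upper and lower order of \<open>\<phi>\<close> and \<open>E\<close> for the set of approximable
  points. For real \<open>s > u\<close> the series \<open>\<Sum> \<phi>(n)\<^sup>s\<close> converges, and \<open>E\<close> is a countable union of limsup
  sets of intervals of radius \<open>\<phi>(n)\<close> about \<open>frac (n \<alpha>) + j\<close>, one for each integer \<open>j\<close>. Hence \<open>E\<close> is
  a null set for the \<open>s\<close>-dimensional measure, which is the upper bound
  (\<open>hausdorff_measure_inhom_null\<close>).

  The lower bound rests on a Riesz product (\<open>hausdorff_dim_limsup_densities\<close>). Let \<open>h\<^sub>n\<close> be
  continuous nonnegative densities on \<open>[0, 1]\<close>, vanishing outside closed sets \<open>A\<^sub>n\<close>, whose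
  distribution functions tend uniformly to the identity and are \<open>t\<close>-Hoelder with a constant that
  does not depend on \<open>n\<close>. For \<open>s < t\<close> and a sufficiently sparse sequence of indices \<open>m\<^sub>0, m\<^sub>1, ...\<close>,
  the functions \<open>x \<mapsto> \<integral>\<^sub>0\<^sup>x h\<^bsub>m\<^sub>0\<^esub> \<cdots> h\<^bsub>m\<^sub>j\<^esub>\<close> converge to a nonconstant \<open>s\<close>-Hoelder
  function \<open>F\<close>. It is locally constant off each set of the subsequence, so up to countably many
  values it takes the whole interval \<open>[F 0, F 1]\<close> on the intersection of these sets. As an
  \<open>s\<close>-Hoelder map sends sets of dimension below \<open>s\<close> to Lebesgue null sets, the limsup set of the
  \<open>A\<^sub>n\<close> has dimension at least \<open>s\<close>. No measure on the limit set has to be constructed.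

  The theorem is applied to averages of bumps of radius \<open>r = \<phi>(N) / 2\<close> about the points
  \<open>frac (n \<alpha>)\<close> with \<open>n \<le> N\<close>, for suitable \<open>N\<close>; since \<open>\<phi>\<close> decreases, the limsup set of their supports
  lies in \<open>E\<close> up to a countable set. Both hypotheses are statements on the number of visits of the
  orbit to an interval of length comparable to \<open>\<rho>\<close>. The first is equidistribution. For the second
  let \<open>q \<le> N\<close> minimise the distance \<open>\<delta>\<close> of \<open>q \<alpha>\<close> to the integers. Orbit points with index up
  to \<open>N\<close> are \<open>\<delta>\<close>-separated, and \<open>q\<close> consecutive ones are within \<open>1 / q\<close> of a grid of mesh \<open>1 / q\<close>.
  This bounds the number of visits by a constant times \<open>N \<rho>\<^sup>t\<close> for all \<open>\<rho> \<ge> r\<close>, provided that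
  \<open>N r\<^sup>t \<ge> 1\<close> and either \<open>1 / q \<le> r\<^sup>t\<close> or \<open>1 / \<delta> \<le> C N q\<^bsup>1/t - 1\<^esup>\<close> (\<open>visits_le_powr\<close>).
  If \<open>t < l\<close>, the choice \<open>N = q\<close> works. If \<open>t < u\<close> and \<open>t < (1 + u) / (1 + \<beta>)\<close>, any \<open>N\<close> for which
  \<open>\<phi>(N)\<close> is at least \<open>2 N\<^bsup>-1/v\<^esup>\<close>, with \<open>v < u\<close> near \<open>u\<close>, works, because the Diophantine
  type bounds \<open>\<delta>\<close> from below.
\<close>

section \<open>Hausdorff null sets and Hoelder functions\<close>

lemma hausdorff_measure_zero_iff:
  fixes A :: "'a::metric_space set"
  shows "hausdorff_measure s A = 0 \<longleftrightarrow>
    (\<forall>\<delta>>0. \<forall>\<epsilon>>0. \<exists>U :: nat \<Rightarrow> 'a set. A \<subseteq> (\<Union>i. U i) \<and>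
       (\<forall>i. bounded (U i) \<and> diameter (U i) \<le> \<delta>) \<and>
       (\<Sum>i. ennreal (hausdorff_gauge s (U i))) \<le> ennreal \<epsilon>)"
proof -
  have "hausdorff_measure s A = 0 \<longleftrightarrow> (\<forall>\<delta>>0. hausdorff_content s \<delta> A = 0)"
  proof -
    have "hausdorff_measure s A = bot \<longleftrightarrow> (\<forall>\<delta>\<in>{0<..}. hausdorff_content s \<delta> A = bot)"
      unfolding hausdorff_measure_def by (rule SUP_bot_conv)
    then show ?thesis by (auto simp: bot_ennreal)
  qed
  moreover have "hausdorff_content s \<delta> A = 0 \<longleftrightarrow> (\<forall>\<epsilon>>0. \<exists>U :: nat \<Rightarrow> 'a set. A \<subseteq> (\<Union>i. U i) \<and>
       (\<forall>i. bounded (U i) \<and> diameter (U i) \<le> \<delta>) \<and>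
       (\<Sum>i. ennreal (hausdorff_gauge s (U i))) \<le> ennreal \<epsilon>)" (is "?L = ?R") for \<delta> :: real
  proof
    assume ?L
    show ?R
    proof (intro allI impI)
      fix \<epsilon> :: real assume "\<epsilon> > 0"
      then have "hausdorff_content s \<delta> A < ennreal \<epsilon>" using \<open>?L\<close> by simp
      then show "\<exists>U :: nat \<Rightarrow> 'a set. A \<subseteq> (\<Union>i. U i) \<and>
       (\<forall>i. bounded (U i) \<and> diameter (U i) \<le> \<delta>) \<and>
       (\<Sum>i. ennreal (hausdorff_gauge s (U i))) \<le> ennreal \<epsilon>"
        unfolding hausdorff_content_def INF_less_iff by (auto intro: less_imp_le)
    qed
  next
    assume R: ?R
    have "hausdorff_content s \<delta> A \<le> 0 + ennreal \<epsilon>" if "\<epsilon> > 0" for \<epsilon>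
    proof -
      from R that obtain U :: "nat \<Rightarrow> 'a set" where
        "A \<subseteq> (\<Union>i. U i)" "\<forall>i. bounded (U i) \<and> diameter (U i) \<le> \<delta>"
        and le: "(\<Sum>i. ennreal (hausdorff_gauge s (U i))) \<le> ennreal \<epsilon>" by blast
      then have "hausdorff_content s \<delta> A \<le> (\<Sum>i. ennreal (hausdorff_gauge s (U i)))"
        unfolding hausdorff_content_def by (intro INF_lower) auto
      with le show ?thesis by simp
    qed
    then have "hausdorff_content s \<delta> A \<le> 0"
      by (rule ennreal_le_epsilon)
    then show ?L by simp
  qed
  ultimately show ?thesis by simp
qed

lemma hausdorff_gauge_nonneg: "0 \<le> hausdorff_gauge s U"
  by (simp add: hausdorff_gauge_def)

lemma hausdorff_measure_mono_null:
  assumes "hausdorff_measure s B = 0" "A \<subseteq> B"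
  shows "hausdorff_measure s A = 0"
  using assms unfolding hausdorff_measure_zero_iff by (meson order_trans)

lemma hausdorff_measure_UN_null:
  fixes A :: "nat \<Rightarrow> 'a::metric_space set"
  assumes null: "\<And>k. hausdorff_measure s (A k) = 0"
  shows "hausdorff_measure s (\<Union>k. A k) = 0"
  unfolding hausdorff_measure_zero_iff
proof (intro allI impI)
  fix \<delta> \<epsilon> :: real
  assume \<delta>: "\<delta> > 0" and \<epsilon>: "\<epsilon> > 0"
  have "\<exists>U :: nat \<Rightarrow> 'a set. A k \<subseteq> (\<Union>i. U i) \<and> (\<forall>i. bounded (U i) \<and> diameter (U i) \<le> \<delta>) \<and>
       (\<Sum>i. ennreal (hausdorff_gauge s (U i))) \<le> ennreal (\<epsilon> * (1/2) ^ Suc k)" for k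
  proof -
    have "0 < \<epsilon> * (1/2) ^ Suc k" using \<epsilon> by simp
    with null[of k, unfolded hausdorff_measure_zero_iff] \<delta> show ?thesis by blast
  qed
  then obtain U :: "nat \<Rightarrow> nat \<Rightarrow> 'a set" where U: "\<And>k. A k \<subseteq> (\<Union>i. U k i)"
      "\<And>k i. bounded (U k i) \<and> diameter (U k i) \<le> \<delta>"
      "\<And>k. (\<Sum>i. ennreal (hausdorff_gauge s (U k i))) \<le> ennreal (\<epsilon> * (1/2) ^ Suc k)"
    by metis
  define V where "V n = (case prod_decode n of (k, i) \<Rightarrow> U k i)" for n
  have "(\<Union>k. A k) \<subseteq> (\<Union>n. V n)"
  proof
    fix x assume "x \<in> (\<Union>k. A k)"
    then obtain k i where "x \<in> U k i" using U(1) by blast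
    then have "x \<in> V (prod_encode (k, i))" by (simp add: V_def)
    then show "x \<in> (\<Union>n. V n)" by blast
  qed
  moreover have "\<forall>n. bounded (V n) \<and> diameter (V n) \<le> \<delta>"
    using U(2) by (auto simp: V_def split: prod.splits)
  moreover have "(\<Sum>n. ennreal (hausdorff_gauge s (V n))) \<le> ennreal \<epsilon>"
  proof -
    have "(\<Sum>n. ennreal (hausdorff_gauge s (V n))) =
        (\<Sum>n. (case prod_decode n of (k, i) \<Rightarrow> ennreal (hausdorff_gauge s (U k i))))"
      by (intro suminf_cong) (auto simp: V_def split: prod.splits)
    also have "\<dots> = (\<Sum>k. \<Sum>i. ennreal (hausdorff_gauge s (U k i)))"
      by (subst suminf_ennreal_2dimen[where f = "\<lambda>(k, i). ennreal (hausdorff_gauge s (U k i))", symmetric])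
         (auto simp: o_def)
    also have "\<dots> \<le> (\<Sum>k. ennreal (\<epsilon> * (1/2) ^ Suc k))"
      using U(3) by (intro suminf_le) auto
    also have "\<dots> = ennreal (\<Sum>k. \<epsilon> * (1/2) ^ Suc k)"
      using \<epsilon> by (intro suminf_ennreal2 summable_mult sums_summable[OF power_half_series]) auto
    also have "(\<Sum>k. \<epsilon> * (1/2) ^ Suc k) = \<epsilon>"
      using sums_mult[OF power_half_series, of \<epsilon>] by (simp add: sums_iff)
    finally show ?thesis .
  qed
  ultimately show "\<exists>U :: nat \<Rightarrow> 'a set. (\<Union>k. A k) \<subseteq> (\<Union>i. U i) \<and>
       (\<forall>i. bounded (U i) \<and> diameter (U i) \<le> \<delta>) \<and>
       (\<Sum>i. ennreal (hausdorff_gauge s (U i))) \<le> ennreal \<epsilon>"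
    by blast
qed

lemma hausdorff_dim_leI: "0 \<le> s \<Longrightarrow> hausdorff_measure s A = 0 \<Longrightarrow> hausdorff_dim A \<le> ereal s"
  unfolding hausdorff_dim_def by (intro Inf_lower) auto

text \<open>The Hausdorff--Cantelli lemma: the tails of the defining sequence of balls are the covers.\<close>

lemma hausdorff_measure_limsup_balls:
  fixes x \<rho> :: "nat \<Rightarrow> real"
  assumes s: "s > 0" and pos: "\<And>n. 0 \<le> \<rho> n" and lim: "\<rho> \<longlonglongrightarrow> 0"
    and sum: "summable (\<lambda>n. \<rho> n powr s)"
  shows "hausdorff_measure s {y. infinite {n. \<bar>x n - y\<bar> < \<rho> n}} = 0"
  unfolding hausdorff_measure_zero_iff
proof (intro allI impI)
  fix \<delta> \<epsilon> :: real
  assume \<delta>: "\<delta> > 0" and \<epsilon>: "\<epsilon> > 0"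
  let ?f = "\<lambda>n. (2 * \<rho> n) powr s"
  have f_eq: "?f = (\<lambda>n. 2 powr s * \<rho> n powr s)"
    using pos by (auto simp: powr_mult)
  have sf: "summable ?f" unfolding f_eq by (intro summable_mult sum)
  have "eventually (\<lambda>n. \<rho> n < \<delta> / 2) sequentially"
    using lim \<delta> by (intro order_tendstoD) auto
  then obtain M1 where M1: "\<And>n. n \<ge> M1 \<Longrightarrow> \<rho> n < \<delta> / 2"
    by (auto simp: eventually_sequentially)
  obtain M2 where M2: "\<And>n. n \<ge> M2 \<Longrightarrow> norm (\<Sum>i. ?f (i + n)) < \<epsilon>"
    using suminf_exist_split[OF \<epsilon> sf] by blast
  define M where "M = max M1 M2"
  define U where "U i = ball (x (i + M)) (\<rho> (i + M))" for i
  have diam: "diameter (U i) \<le> 2 * \<rho> (i + M)" for i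
    unfolding U_def using pos[of "i + M"] by (simp add: diameter_ball)
  have "{y. infinite {n. \<bar>x n - y\<bar> < \<rho> n}} \<subseteq> (\<Union>i. U i)"
  proof
    fix y assume "y \<in> {y. infinite {n. \<bar>x n - y\<bar> < \<rho> n}}"
    then obtain n where "n \<ge> M" "\<bar>x n - y\<bar> < \<rho> n"
      unfolding infinite_nat_iff_unbounded_le by blast
    then have "y \<in> U (n - M)" by (simp add: U_def dist_real_def)
    then show "y \<in> (\<Union>i. U i)" by blast
  qed
  moreover have "\<forall>i. bounded (U i) \<and> diameter (U i) \<le> \<delta>"
  proof
    fix i
    have "\<rho> (i + M) < \<delta> / 2" by (intro M1) (simp add: M_def)
    with diam[of i] have "diameter (U i) \<le> \<delta>" by linarith
    then show "bounded (U i) \<and> diameter (U i) \<le> \<delta>" by (simp add: U_def)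
  qed
  moreover have "(\<Sum>i. ennreal (hausdorff_gauge s (U i))) \<le> ennreal \<epsilon>"
  proof -
    have g: "hausdorff_gauge s (U i) \<le> ?f (i + M)" for i
      using diam[of i] s by (auto simp: hausdorff_gauge_def U_def intro!: powr_mono2 diameter_ge_0)
    have "(\<Sum>i. ennreal (hausdorff_gauge s (U i))) \<le> (\<Sum>i. ennreal (?f (i + M)))"
      by (intro suminf_le ennreal_leI g) auto
    also have "\<dots> = ennreal (\<Sum>i. ?f (i + M))"
      using summable_ignore_initial_segment[OF sf, of M] by (intro suminf_ennreal2) auto
    also have "\<dots> \<le> ennreal \<epsilon>"
      using M2[of M] by (intro ennreal_leI) (simp add: M_def)
    finally show ?thesis .
  qed
  ultimately show "\<exists>U :: nat \<Rightarrow> real set. {y. infinite {n. \<bar>x n - y\<bar> < \<rho> n}} \<subseteq> (\<Union>i. U i) \<and>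
       (\<forall>i. bounded (U i) \<and> diameter (U i) \<le> \<delta>) \<and>
       (\<Sum>i. ennreal (hausdorff_gauge s (U i))) \<le> ennreal \<epsilon>"
    by blast
qed

text \<open>
  An \<open>s\<close>-Hoelder function maps a set whose \<open>\<sigma>\<close>-dimensional measure vanishes for some \<open>\<sigma> < s\<close> to a
  Lebesgue null set.
\<close>

lemma hausdorff_dim_ge_Hoelder:
  fixes F :: "real \<Rightarrow> real" and X :: "real set"
  assumes K: "K > 0"
    and hoelder: "\<And>x y. x \<in> X \<Longrightarrow> y \<in> X \<Longrightarrow> \<bar>F x - F y\<bar> \<le> K * \<bar>x - y\<bar> powr s"
    and notnull: "\<not> negligible (F ` X)"
  shows "ereal s \<le> hausdorff_dim X"
  unfolding hausdorff_dim_def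
proof (rule Inf_greatest, clarify)
  fix \<sigma> :: real
  assume \<sigma>: "0 \<le> \<sigma>" and null: "hausdorff_measure \<sigma> X = 0"
  show "ereal s \<le> ereal \<sigma>"
  proof (rule ccontr)
    assume "\<not> ereal s \<le> ereal \<sigma>"
    then have less: "\<sigma> < s" by simp
    have "negligible (F ` X)"
      unfolding negligible_outer_le
    proof (intro allI impI)
      fix \<epsilon> :: real assume \<epsilon>: "\<epsilon> > 0"
      then have "\<epsilon> / (2 * K) > 0" using K by simp
      then obtain U :: "nat \<Rightarrow> real set" where U: "X \<subseteq> (\<Union>i. U i)"
        "\<And>i. bounded (U i)" "\<And>i. diameter (U i) \<le> 1"
        and sumU: "(\<Sum>i. ennreal (hausdorff_gauge \<sigma> (U i))) \<le> ennreal (\<epsilon> / (2 * K))"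
        using null[unfolded hausdorff_measure_zero_iff] zero_less_one by metis
      define c where "c i = F (SOME x. x \<in> X \<inter> U i)" for i
      define g where "g i = K * hausdorff_gauge \<sigma> (U i)" for i
      have g0: "g i \<ge> 0" for i using K by (simp add: g_def hausdorff_gauge_nonneg)
      define T where "T = (\<Union>i. {c i - g i .. c i + g i})"
      have "F ` X \<subseteq> T"
      proof
        fix z assume "z \<in> F ` X"
        then obtain x i where x: "x \<in> X" "z = F x" "x \<in> U i" using U(1) by blast
        define x' where "x' = (SOME x. x \<in> X \<inter> U i)"
        have x': "x' \<in> X \<inter> U i" unfolding x'_def using x by (intro someI[where P = "\<lambda>x. x \<in> X \<inter> U i" and x = x]) blast
        have "\<bar>x - x'\<bar> \<le> diameter (U i)"
          using diameter_bounded_bound[OF U(2), of x i x'] x x' by (simp add: dist_real_def)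
        then have "\<bar>x - x'\<bar> powr s \<le> diameter (U i) powr s"
          using less \<sigma> by (intro powr_mono2) auto
        also have "\<dots> \<le> hausdorff_gauge \<sigma> (U i)"
        proof -
          have "diameter (U i) powr s \<le> diameter (U i) powr \<sigma>"
            using less diameter_ge_0[OF U(2)] U(3) by (intro powr_mono') auto
          moreover have "diameter (U i) powr s \<le> 1"
            using less \<sigma> diameter_ge_0[OF U(2)] U(3) by (intro powr_le1) auto
          ultimately show ?thesis using x by (auto simp: hausdorff_gauge_def)
        qed
        finally have "\<bar>F x - F x'\<bar> \<le> g i"
          using hoelder[of x x'] x x' K unfolding g_def
          by (smt (verit) IntD1 mult_left_mono)
        then have "z \<in> {c i - g i .. c i + g i}"
          using x by (auto simp: c_def x'_def abs_le_iff)
        then show "z \<in> T" unfolding T_def by blast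
      qed
      moreover have em: "emeasure lebesgue T \<le> ennreal \<epsilon>"
      proof -
        have "emeasure lebesgue T \<le> (\<Sum>i. emeasure lebesgue {c i - g i .. c i + g i})"
          unfolding T_def by (intro emeasure_subadditive_countably) auto
        also have "\<dots> = (\<Sum>i. ennreal (2 * K) * ennreal (hausdorff_gauge \<sigma> (U i)))"
          using K g0 by (intro suminf_cong)
            (auto simp: g_def ennreal_mult[symmetric] hausdorff_gauge_nonneg)
        also have "\<dots> = ennreal (2 * K) * (\<Sum>i. ennreal (hausdorff_gauge \<sigma> (U i)))"
          by (rule ennreal_suminf_cmult)
        also have "\<dots> \<le> ennreal (2 * K) * ennreal (\<epsilon> / (2 * K))"
          by (intro mult_left_mono sumU) auto
        also have "\<dots> = ennreal \<epsilon>"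
          using K \<epsilon> by (simp add: ennreal_mult[symmetric])
        finally show ?thesis .
      qed
      moreover have "T \<in> sets lebesgue" unfolding T_def by auto
      moreover from this em have "T \<in> lmeasurable"
        by (intro fmeasurableI) (auto intro: le_less_trans)
      moreover have "measure lebesgue T \<le> \<epsilon>"
        unfolding measure_def using em \<epsilon> by (intro enn2real_leI) auto
      ultimately show "\<exists>T. F ` X \<subseteq> T \<and> T \<in> lmeasurable \<and> measure lebesgue T \<le> \<epsilon>"
        by blast
    qed
    with notnull show False by simp
  qed
qed

section \<open>Limsup sets of supports of densities\<close>

lemma integral_eq_0:
  fixes f :: "real \<Rightarrow> real"
  assumes "\<And>z. z \<in> S \<Longrightarrow> f z = 0"
  shows "integral S f = 0"
  using integral_cong[of S f "\<lambda>_. 0"] assms by simp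

text \<open>
  Weak convergence \<open>h\<^sub>n dx \<rightarrow> dx\<close>, uniformly on initial intervals. A polynomial in place of \<open>H\<close> allows
  integration by parts against the small function \<open>\<integral>\<^sub>0\<^sup>z h\<^sub>n - z\<close>.
\<close>

lemma integral_mult_density_uniform:
  fixes h :: "nat \<Rightarrow> real \<Rightarrow> real"
  assumes cont: "\<And>n. continuous_on {0..1} (h n)" and nonneg: "\<And>n x. 0 \<le> h n x"
    and H: "continuous_on {0..1} H"
    and unif: "\<And>\<epsilon>. \<epsilon> > 0 \<Longrightarrow>
      \<forall>\<^sub>F n in sequentially. \<forall>x\<in>{0..1}. \<bar>integral {0..x} (h n) - x\<bar> \<le> \<epsilon>"
    and \<epsilon>: "\<epsilon> > 0"
  shows "\<forall>\<^sub>F n in sequentially. \<forall>x\<in>{0..1}.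
    \<bar>integral {0..x} (\<lambda>z. H z * h n z) - integral {0..x} H\<bar> \<le> \<epsilon>"
proof -
  obtain P where P: "real_polynomial_function P"
    and HP: "\<And>x. x \<in> {0..1} \<Longrightarrow> \<bar>H x - P x\<bar> < \<epsilon> / 6"
    using Stone_Weierstrass_real_polynomial_function[of "{0..1::real}" H "\<epsilon> / 6"] H \<epsilon> by auto
  obtain P' where P': "polynomial_function P'" and dP: "\<And>x. (P has_vector_derivative P' x) (at x)"
    using has_vector_derivative_polynomial_function[of P] P by (auto simp: real_polynomial_function_eq)
  have contP: "continuous_on S P" and contP': "continuous_on S P'" for S
    using P P' by (auto simp: real_polynomial_function_eq intro: continuous_on_polymonial_function)
  have "bounded (P ` {0..1})" "bounded (P' ` {0..1})"
    by (intro compact_imp_bounded compact_continuous_image contP contP'; simp)+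
  then obtain B1 B2 where "\<And>x. x \<in> {0..1} \<Longrightarrow> \<bar>P x\<bar> \<le> B1" "\<And>x. x \<in> {0..1} \<Longrightarrow> \<bar>P' x\<bar> \<le> B2"
    unfolding bounded_iff by fastforce
  then obtain B where B: "B > 0" "\<And>x. x \<in> {0..1} \<Longrightarrow> \<bar>P x\<bar> \<le> B" "\<And>x. x \<in> {0..1} \<Longrightarrow> \<bar>P' x\<bar> \<le> B"
    by (rule_tac that[of "max 1 (max B1 B2)"]) force+
  define \<eta> where "\<eta> = min 1 (\<epsilon> / (4 * B))"
  have \<eta>: "\<eta> > 0" "\<eta> \<le> 1" "\<eta> * B \<le> \<epsilon> / 4"
    using \<epsilon> B(1) by (auto simp: \<eta>_def min_def field_simps)
  from unif[OF \<eta>(1)] show ?thesis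
  proof eventually_elim
    case (elim n)
    show ?case
    proof
      fix x :: real assume x: "x \<in> {0..1}"
      then have sub: "{0..x} \<subseteq> {0..1}" by auto
      note c [continuous_intros] = continuous_on_subset[OF cont[of n] sub] continuous_on_subset[OF H sub]
        contP contP'
      define G where "G z = integral {0..z} (h n) - z" for z
      have G: "\<bar>G z\<bar> \<le> \<eta>" if "z \<in> {0..1}" for z using elim that by (simp add: G_def)
      have dG: "(G has_vector_derivative (h n z - 1)) (at z within {0..x})" if "z \<in> {0..x}" for z
        unfolding G_def by (intro derivative_intros integral_has_vector_derivative c that)
      have contG [continuous_intros]: "continuous_on {0..x} G"
        unfolding continuous_on_eq_continuous_within using dG has_vector_derivative_continuous by blast
      have ftc: "((\<lambda>z. P z * (h n z - 1) + P' z * G z) has_integral (P x * G x - P 0 * G 0)) {0..x}"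
      proof (rule fundamental_theorem_of_calculus)
        show "0 \<le> x" using x by simp
        fix z assume z: "z \<in> {0..x}"
        show "((\<lambda>z. P z * G z) has_vector_derivative P z * (h n z - 1) + P' z * G z) (at z within {0..x})"
          by (rule has_vector_derivative_mult[OF has_vector_derivative_at_within[OF dP] dG[OF z]])
      qed
      have int1: "(\<lambda>z. P z * (h n z - 1)) integrable_on {0..x}"
        and int2: "(\<lambda>z. P' z * G z) integrable_on {0..x}"
        by (intro integrable_continuous_real continuous_intros)+
      have "integral {0..x} (\<lambda>z. P z * (h n z - 1)) + integral {0..x} (\<lambda>z. P' z * G z) = P x * G x"
        using integral_unique[OF ftc] integral_add[OF int1 int2] by (simp add: G_def)
      moreover have "\<bar>P x * G x\<bar> \<le> B * \<eta>"
        unfolding abs_mult using B(2)[OF x] G[OF x] by (intro mult_mono) auto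
      moreover have "\<bar>integral {0..x} (\<lambda>z. P' z * G z)\<bar> \<le> B * \<eta> * (x - 0)"
      proof -
        have "\<bar>P' z * G z\<bar> \<le> B * \<eta>" if "z \<in> {0..x}" for z
          unfolding abs_mult using B(3)[of z] G[of z] that sub by (intro mult_mono) auto
        then show ?thesis
          using integral_bound[of 0 x "\<lambda>z. P' z * G z" "B * \<eta>"] x by (auto intro!: continuous_intros)
      qed
      moreover have "B * \<eta> * (x - 0) \<le> B * \<eta>"
        using x B(1) \<eta>(1) by (simp add: mult_left_le)
      ultimately have 1: "\<bar>integral {0..x} (\<lambda>z. P z * (h n z - 1))\<bar> \<le> \<epsilon> / 2"
        using \<eta>(3) by (simp add: mult.commute)
      have int3: "(\<lambda>z. (H z - P z) * (h n z - 1)) integrable_on {0..x}"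
        and int4: "(\<lambda>z. \<epsilon> / 6 * (h n z + 1)) integrable_on {0..x}"
        and int5: "h n integrable_on {0..x}"
        and int6: "(\<lambda>z. H z * h n z) integrable_on {0..x}" and int7: "H integrable_on {0..x}"
        by (intro integrable_continuous_real continuous_intros)+
      have "norm (integral {0..x} (\<lambda>z. (H z - P z) * (h n z - 1)))
          \<le> integral {0..x} (\<lambda>z. \<epsilon> / 6 * (h n z + 1))"
      proof (rule integral_norm_bound_integral[OF int3 int4])
        fix z assume z: "z \<in> {0..x}"
        have "\<bar>H z - P z\<bar> \<le> \<epsilon> / 6" using HP[of z] z sub by force
        moreover have "\<bar>h n z - 1\<bar> \<le> h n z + 1" using nonneg[of n z] by simp
        ultimately show "norm ((H z - P z) * (h n z - 1)) \<le> \<epsilon> / 6 * (h n z + 1)"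
          unfolding real_norm_def abs_mult using \<epsilon> by (intro mult_mono) auto
      qed
      also have "\<dots> = \<epsilon> / 6 * (integral {0..x} (h n) + x)"
        using x integral_add[OF int5 integrable_const_ivl[of 1]] by simp
      also have "\<dots> \<le> \<epsilon> / 6 * 3"
        using G[OF x] \<eta>(2) x \<epsilon> by (intro mult_left_mono) (auto simp: G_def)
      finally have 2: "\<bar>integral {0..x} (\<lambda>z. (H z - P z) * (h n z - 1))\<bar> \<le> \<epsilon> / 2" by simp
      have "integral {0..x} (\<lambda>z. H z * h n z) - integral {0..x} H
          = integral {0..x} (\<lambda>z. H z * h n z - H z)"
        using int6 int7 by (simp add: integral_diff)
      also have "\<dots> = integral {0..x} (\<lambda>z. P z * (h n z - 1) + (H z - P z) * (h n z - 1))"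
        by (intro integral_cong) (simp add: algebra_simps)
      also have "\<dots> = integral {0..x} (\<lambda>z. P z * (h n z - 1)) +
           integral {0..x} (\<lambda>z. (H z - P z) * (h n z - 1))"
        by (rule integral_add[OF int1 int3])
      finally show "\<bar>integral {0..x} (\<lambda>z. H z * h n z) - integral {0..x} H\<bar> \<le> \<epsilon>"
        using 1 2 by linarith
    qed
  qed
qed

lemma integral_0_diff:
  fixes f :: "real \<Rightarrow> real"
  assumes "continuous_on {0..1} f" "0 \<le> x" "x \<le> y" "y \<le> 1"
  shows "integral {x..y} f = integral {0..y} f - integral {0..x} f"
proof -
  have "f integrable_on {0..y}"
    using assms by (intro integrable_continuous_real continuous_on_subset[OF assms(1)]) auto
  from Henstock_Kurzweil_Integration.integral_combine[OF assms(2,3) this] show ?thesis by simp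
qed

text \<open>
  One more factor in the product increases the \<open>s\<close>-Hoelder constant of the distribution function by
  as little as desired. On long intervals this is weak convergence; on short ones the uniform
  exponent \<open>t > s\<close> of \<open>h n\<close> outweighs the supremum of \<open>H\<close>.
\<close>

lemma density_product_step:
  fixes h :: "nat \<Rightarrow> real \<Rightarrow> real"
  assumes cont: "\<And>n. continuous_on {0..1} (h n)" and nonneg: "\<And>n x. 0 \<le> h n x"
    and unif: "\<And>\<epsilon>. \<epsilon> > 0 \<Longrightarrow>
      \<forall>\<^sub>F n in sequentially. \<forall>x\<in>{0..1}. \<bar>integral {0..x} (h n) - x\<bar> \<le> \<epsilon>"
    and hoelder: "\<And>n x y. 0 \<le> x \<Longrightarrow> x \<le> y \<Longrightarrow> y \<le> 1 \<Longrightarrow> integral {x..y} (h n) \<le> C * (y - x) powr t"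
    and s: "s > 0" and st: "s < t" and C: "C > 0"
    and H: "continuous_on {0..1} H" and H0: "\<And>x. 0 \<le> H x"
    and HK: "\<And>x y. 0 \<le> x \<Longrightarrow> x \<le> y \<Longrightarrow> y \<le> 1 \<Longrightarrow> integral {x..y} H \<le> K * (y - x) powr s"
    and K: "1 \<le> K" and \<eta>: "\<eta> > 0"
  shows "\<forall>\<^sub>F n in sequentially.
     (\<forall>x\<in>{0..1}. \<bar>integral {0..x} (\<lambda>z. H z * h n z) - integral {0..x} H\<bar> \<le> \<eta>) \<and>
     (\<forall>x y. 0 \<le> x \<longrightarrow> x \<le> y \<longrightarrow> y \<le> 1 \<longrightarrow>
        integral {x..y} (\<lambda>z. H z * h n z) \<le> (K + \<eta>) * (y - x) powr s)"
proof -
  have "bounded (H ` {0..1})"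
    by (intro compact_imp_bounded compact_continuous_image H) simp
  then obtain B0 where "\<And>x. x \<in> {0..1} \<Longrightarrow> \<bar>H x\<bar> \<le> B0"
    unfolding bounded_iff by fastforce
  then obtain B where B: "B > 0" "\<And>x. x \<in> {0..1} \<Longrightarrow> H x \<le> B"
    by (rule_tac that[of "max 1 B0"]) force+
  \<comment> \<open>Below the scale \<open>\<delta>\<close> the spare exponent \<open>t - s\<close> absorbs the bound \<open>B\<close> of \<open>H\<close>.\<close>
  define \<delta> where "\<delta> = (1 / (B * C)) powr (1 / (t - s))"
  have \<delta>: "\<delta> > 0" "B * C * \<delta> powr (t - s) = 1"
    using B(1) C st by (auto simp: \<delta>_def powr_powr)
  define \<eta>' where "\<eta>' = min \<eta> (\<eta> * \<delta> powr s / 2)"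
  have \<eta>': "\<eta>' > 0" "\<eta>' \<le> \<eta>" "2 * \<eta>' \<le> \<eta> * \<delta> powr s"
    using \<eta> \<delta>(1) by (auto simp: \<eta>'_def)
  have "\<forall>\<^sub>F n in sequentially. \<forall>x\<in>{0..1}.
      \<bar>integral {0..x} (\<lambda>z. H z * h n z) - integral {0..x} H\<bar> \<le> \<eta>'"
    by (rule integral_mult_density_uniform[OF cont nonneg H]) (use unif \<eta>'(1) in auto)
  then show ?thesis
  proof eventually_elim
    case (elim n)
    have contHh: "continuous_on {0..1} (\<lambda>z. H z * h n z)"
      by (intro continuous_intros H cont)
    have "integral {x..y} (\<lambda>z. H z * h n z) \<le> (K + \<eta>) * (y - x) powr s"
      if xy: "0 \<le> x" "x \<le> y" "y \<le> 1" for x y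
    proof (cases "y - x \<le> \<delta>")
      case True
      have sub: "{x..y} \<subseteq> {0..1}" using xy by auto
      have "integral {x..y} (\<lambda>z. H z * h n z) \<le> integral {x..y} (\<lambda>z. B * h n z)"
      proof (rule integral_le)
        show "(\<lambda>z. H z * h n z) integrable_on {x..y}" "(\<lambda>z. B * h n z) integrable_on {x..y}"
          by (intro integrable_continuous_real continuous_intros continuous_on_subset[OF H sub]
                continuous_on_subset[OF cont sub])+
        show "H z * h n z \<le> B * h n z" if "z \<in> {x..y}" for z
          using B(2) that sub nonneg by (intro mult_right_mono) auto
      qed
      also have "\<dots> = B * integral {x..y} (h n)" by simp
      also have "\<dots> \<le> B * (C * (y - x) powr t)"
        using hoelder[OF xy] B(1) by (intro mult_left_mono) auto
      also have "\<dots> = B * C * (y - x) powr (t - s) * (y - x) powr s"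
        by (simp add: powr_add[symmetric])
      also have "\<dots> \<le> B * C * \<delta> powr (t - s) * (y - x) powr s"
        using B(1) C st xy True by (intro mult_right_mono mult_left_mono powr_mono2) auto
      also have "\<dots> \<le> (K + \<eta>) * (y - x) powr s"
        unfolding \<delta>(2) using K \<eta> by (intro mult_right_mono) auto
      finally show ?thesis .
    next
      case False
      have "integral {x..y} (\<lambda>z. H z * h n z) =
          integral {0..y} (\<lambda>z. H z * h n z) - integral {0..x} (\<lambda>z. H z * h n z)"
        by (rule integral_0_diff[OF contHh xy])
      also have "\<dots> \<le> integral {x..y} H + 2 * \<eta>'"
        using bspec[OF elim, of x] bspec[OF elim, of y] xy integral_0_diff[OF H xy]
        by (simp add: abs_le_iff)
      also have "\<dots> \<le> K * (y - x) powr s + \<eta> * \<delta> powr s"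
        using HK[OF xy] \<eta>'(3) by linarith
      also have "\<dots> \<le> K * (y - x) powr s + \<eta> * (y - x) powr s"
        using False \<delta>(1) s \<eta> by (intro add_left_mono mult_left_mono powr_mono2) auto
      finally show ?thesis by (simp add: algebra_simps)
    qed
    moreover have "\<forall>x\<in>{0..1}. \<bar>integral {0..x} (\<lambda>z. H z * h n z) - integral {0..x} H\<bar> \<le> \<eta>"
      using elim \<eta>'(2) by force
    ultimately show ?case by blast
  qed
qed

text \<open>
  The Riesz product argument. The exceptional countable set \<open>D\<close> is harmless because its image under
  \<open>F\<close> is countable.
\<close>

theorem hausdorff_dim_limsup_densities:
  fixes h :: "nat \<Rightarrow> real \<Rightarrow> real"
  assumes cont: "\<And>n. continuous_on {0..1} (h n)" and nonneg: "\<And>n x. 0 \<le> h n x"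
    and unif: "\<And>\<epsilon>. \<epsilon> > 0 \<Longrightarrow>
      \<forall>\<^sub>F n in sequentially. \<forall>x\<in>{0..1}. \<bar>integral {0..x} (h n) - x\<bar> \<le> \<epsilon>"
    and hoelder: "\<And>n x y. 0 \<le> x \<Longrightarrow> x \<le> y \<Longrightarrow> y \<le> 1 \<Longrightarrow> integral {x..y} (h n) \<le> C * (y - x) powr t"
    and s: "s > 0" and st: "s < t" and s1: "s \<le> 1" and C: "C > 0"
    and clos: "\<And>n. closed (A n)" and zero: "\<And>n x. x \<notin> A n \<Longrightarrow> h n x = 0"
    and D: "countable D"
    and E: "\<And>y. y \<in> {0..1} \<Longrightarrow> infinite {n. y \<in> A n} \<Longrightarrow> y \<notin> D \<Longrightarrow> y \<in> E"
  shows "ereal s \<le> hausdorff_dim E"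
proof -
  \<comment> \<open>A state is a pair of the product so far and the last index used. Its \<open>s\<close>-Hoelder constant
     stays below \<open>3 / 2\<close> and its mass above \<open>1 / 2\<close>.\<close>
  define K :: "nat \<Rightarrow> real" where "K j = 3/2 - (1/2) ^ Suc j" for j
  define P :: "nat \<Rightarrow> (real \<Rightarrow> real) \<times> nat \<Rightarrow> bool" where
    "P j p \<longleftrightarrow> (case p of (H, m) \<Rightarrow> continuous_on {0..1} H \<and> (\<forall>x. 0 \<le> H x) \<and>
       (\<forall>x y. 0 \<le> x \<longrightarrow> x \<le> y \<longrightarrow> y \<le> 1 \<longrightarrow> integral {x..y} H \<le> K j * (y - x) powr s) \<and>
       1/2 + (1/2) ^ Suc j \<le> integral {0..1} H)" for j p
  define Q :: "nat \<Rightarrow> (real \<Rightarrow> real) \<times> nat \<Rightarrow> (real \<Rightarrow> real) \<times> nat \<Rightarrow> bool" where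
    "Q j p p' \<longleftrightarrow> (case p of (H, m) \<Rightarrow> case p' of (H', m') \<Rightarrow>
       m < m' \<and> H' = (\<lambda>z. H z * h m' z) \<and>
       (\<forall>x\<in>{0..1}. \<bar>integral {0..x} H' - integral {0..x} H\<bar> \<le> (1/2) ^ Suc (Suc j)))" for j p p'
  have "\<exists>f. \<forall>j. P j (f j) \<and> Q j (f j) (f (Suc j))"
  proof (rule dependent_nat_choice)
    have "y - x \<le> (y - x) powr s" if "0 \<le> x" "x \<le> y" "y \<le> 1" for x y :: real
      using powr_mono'[of s 1 "y - x"] that s1 by simp
    then have "P 0 (\<lambda>_. 1, 0)" by (simp add: P_def K_def)
    then show "\<exists>p. P 0 p" by blast
  next
    fix p j assume Pp: "P j p"
    obtain H m where p: "p = (H, m)" by force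
    have H: "continuous_on {0..1} H" "\<And>x. 0 \<le> H x"
      "\<And>x y. 0 \<le> x \<Longrightarrow> x \<le> y \<Longrightarrow> y \<le> 1 \<Longrightarrow> integral {x..y} H \<le> K j * (y - x) powr s"
      and mass: "1/2 + (1/2) ^ Suc j \<le> integral {0..1} H"
      using Pp by (auto simp: P_def p)
    define \<eta> :: real where "\<eta> = (1/2) ^ Suc (Suc j)"
    have \<eta>: "\<eta> > 0" by (simp add: \<eta>_def)
    have K1: "1 \<le> K j" using power_le_one[of "1/2 :: real" j] by (simp add: K_def)
    have "\<forall>\<^sub>F n in sequentially.
     (\<forall>x\<in>{0..1}. \<bar>integral {0..x} (\<lambda>z. H z * h n z) - integral {0..x} H\<bar> \<le> \<eta>) \<and>
     (\<forall>x y. 0 \<le> x \<longrightarrow> x \<le> y \<longrightarrow> y \<le> 1 \<longrightarrow>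
        integral {x..y} (\<lambda>z. H z * h n z) \<le> (K j + \<eta>) * (y - x) powr s)"
      by (rule density_product_step[where C = C and t = t])
         (use cont nonneg unif hoelder s st C H K1 \<eta> in auto)
    moreover have "\<forall>\<^sub>F n in sequentially. m < n" by (rule eventually_gt_at_top)
    ultimately have "\<forall>\<^sub>F n in sequentially. m < n \<and>
     (\<forall>x\<in>{0..1}. \<bar>integral {0..x} (\<lambda>z. H z * h n z) - integral {0..x} H\<bar> \<le> \<eta>) \<and>
     (\<forall>x y. 0 \<le> x \<longrightarrow> x \<le> y \<longrightarrow> y \<le> 1 \<longrightarrow>
        integral {x..y} (\<lambda>z. H z * h n z) \<le> (K j + \<eta>) * (y - x) powr s)"
      by eventually_elim blast
    then obtain n where n: "m < n"
      "\<And>x. x\<in>{0..1} \<Longrightarrow> \<bar>integral {0..x} (\<lambda>z. H z * h n z) - integral {0..x} H\<bar> \<le> \<eta>"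
      "\<And>x y. 0 \<le> x \<Longrightarrow> x \<le> y \<Longrightarrow> y \<le> 1 \<Longrightarrow>
        integral {x..y} (\<lambda>z. H z * h n z) \<le> (K j + \<eta>) * (y - x) powr s"
      unfolding eventually_sequentially by blast
    have KS: "K (Suc j) = K j + \<eta>" by (simp add: K_def \<eta>_def)
    have "\<bar>integral {0..1} (\<lambda>z. H z * h n z) - integral {0..1} H\<bar> \<le> \<eta>" by (rule n(2)) simp
    moreover have "(1/2) ^ Suc j = 2 * \<eta>" by (simp add: \<eta>_def)
    ultimately have "1/2 + (1/2) ^ Suc (Suc j) \<le> integral {0..1} (\<lambda>z. H z * h n z)"
      using mass unfolding \<eta>_def[symmetric] by linarith
    moreover have "continuous_on {0..1} (\<lambda>z. H z * h n z)" by (intro continuous_intros H cont)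
    ultimately have "P (Suc j) (\<lambda>z. H z * h n z, n)"
      using n H nonneg by (simp add: P_def KS)
    moreover have "Q j p (\<lambda>z. H z * h n z, n)"
      using n by (simp add: Q_def p \<eta>_def)
    ultimately show "\<exists>p'. P (Suc j) p' \<and> Q j p p'" by blast
  qed
  then obtain f where f: "\<And>j. P j (f j)" "\<And>j. Q j (f j) (f (Suc j))" by blast
  define H where "H j = fst (f j)" for j
  define m where "m j = snd (f j)" for j
  have fj: "f j = (H j, m j)" for j by (simp add: H_def m_def)
  have contH: "continuous_on {0..1} (H j)" and H0: "0 \<le> H j x"
    and HK: "0 \<le> x \<Longrightarrow> x \<le> y \<Longrightarrow> y \<le> 1 \<Longrightarrow> integral {x..y} (H j) \<le> K j * (y - x) powr s"
    and mass: "1/2 + (1/2) ^ Suc j \<le> integral {0..1} (H j)" for j x y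
    using f(1)[of j] by (auto simp: P_def fj)
  have m_less: "m j < m (Suc j)" and H_Suc: "H (Suc j) = (\<lambda>z. H j z * h (m (Suc j)) z)"
    and diff: "x \<in> {0..1} \<Longrightarrow> \<bar>integral {0..x} (H (Suc j)) - integral {0..x} (H j)\<bar> \<le> (1/2) ^ Suc (Suc j)"
    for j x using f(2)[of j] by (auto simp: Q_def fj)
  have m_mono: "strict_mono m" using m_less by (simp add: strict_mono_Suc_iff)
  define F where "F x = lim (\<lambda>j. integral {0..x} (H j))" for x
  have F_lim: "(\<lambda>j. integral {0..x} (H j)) \<longlonglongrightarrow> F x" if x: "x \<in> {0..1}" for x
  proof -
    have "summable (\<lambda>j. integral {0..x} (H (Suc j)) - integral {0..x} (H j))"
    proof (rule summable_comparison_test)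
      show "\<exists>N. \<forall>j\<ge>N. norm (integral {0..x} (H (Suc j)) - integral {0..x} (H j)) \<le> (1/2) ^ Suc (Suc j)"
        using diff[OF x] by auto
      show "summable (\<lambda>j. (1/2 :: real) ^ Suc (Suc j))"
        by (simp add: summable_geometric)
    qed
    then have "convergent (\<lambda>n. \<Sum>j<n. integral {0..x} (H (Suc j)) - integral {0..x} (H j))"
      by (simp add: summable_iff_convergent)
    then have "convergent (\<lambda>n. integral {0..x} (H n) - integral {0..x} (H 0))"
      by (simp only: sum_lessThan_telescope[of "\<lambda>j. integral {0..x} (H j)"])
    then have "convergent (\<lambda>n. integral {0..x} (H n))"
      by (simp add: convergent_diff_const_right_iff)
    then show ?thesis unfolding F_def by (simp add: convergent_LIMSEQ_iff)
  qed
  have K2: "K j \<le> 2" for j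
  proof -
    have "0 < (1/2 :: real) ^ Suc j" by simp
    then show ?thesis unfolding K_def by linarith
  qed
  have F_mono_hoelder: "0 \<le> F y - F x \<and> F y - F x \<le> 2 * (y - x) powr s"
    if xy: "0 \<le> x" "x \<le> y" "y \<le> 1" for x y
  proof -
    have lim: "(\<lambda>j. integral {x..y} (H j)) \<longlonglongrightarrow> F y - F x"
      unfolding integral_0_diff[OF contH xy] using xy by (intro tendsto_diff F_lim) auto
    have "integral {x..y} (H j) \<le> 2 * (y - x) powr s" for j
      using HK[OF xy, of j] mult_right_mono[OF K2[of j], of "(y - x) powr s"] by simp
    moreover have "0 \<le> integral {x..y} (H j)" for j
      by (intro integral_nonneg integrable_continuous_real continuous_on_subset[OF contH])
         (use xy H0 in auto)
    ultimately show ?thesis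
      using LIMSEQ_le_const[OF lim, of 0] LIMSEQ_le_const2[OF lim, of "2 * (y - x) powr s"] by auto
  qed
  have F_hoelder: "\<bar>F x - F y\<bar> \<le> 2 * \<bar>x - y\<bar> powr s" if "x \<in> {0..1}" "y \<in> {0..1}" for x y
    using F_mono_hoelder[of x y] F_mono_hoelder[of y x] that by (cases "x \<le> y") auto
  have F_cont: "continuous_on {0..1} F"
    unfolding continuous_on_def
  proof
    fix x :: real assume x: "x \<in> {0..1}"
    have "((\<lambda>y. 2 * \<bar>y - x\<bar> powr s) \<longlongrightarrow> 2 * \<bar>x - x\<bar> powr s) (at x within {0..1})"
      using s by (intro tendsto_intros) auto
    then have "((\<lambda>y. 2 * \<bar>y - x\<bar> powr s) \<longlongrightarrow> 0) (at x within {0..1})" by simp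
    moreover have "\<forall>\<^sub>F y in at x within {0..1}. norm (F y - F x) \<le> 2 * \<bar>y - x\<bar> powr s"
      using F_hoelder x by (auto simp: eventually_at_filter)
    ultimately have "((\<lambda>y. F y - F x) \<longlongrightarrow> 0) (at x within {0..1})"
      by (rule Lim_null_comparison[rotated])
    then show "(F \<longlongrightarrow> F x) (at x within {0..1})" by (simp add: Lim_null[symmetric])
  qed
  have F0: "F 0 = 0" using F_lim[of 0] by (auto dest: LIMSEQ_unique[OF tendsto_const])
  have F1: "1/2 \<le> F 1"
  proof (rule LIMSEQ_le_const[OF F_lim])
    show "\<exists>N. \<forall>n\<ge>N. 1 / 2 \<le> integral {0..1} (H n)"
    proof (intro exI allI impI)
      fix n :: nat
      have "0 < (1/2 :: real) ^ Suc n" by simp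
      then show "1 / 2 \<le> integral {0..1} (H n)" using mass[of n] by linarith
    qed
  qed simp
  have H_zero: "H (Suc i + k) z = 0" if "z \<notin> A (m (Suc i))" for i k z
    by (induction k) (use that zero in \<open>auto simp: H_Suc\<close>)
  \<comment> \<open>Off each set of the subsequence, \<open>F\<close> is locally constant, hence takes only values that it
     already takes at rational points.\<close>
  have F_const: "F x \<in> F ` (\<rat> \<inter> {0..1})" if x: "x \<in> {0..1}" "x \<notin> A (m (Suc i))" for x i
  proof -
    have F_eq: "F y = F z"
      if yz: "0 \<le> y" "y \<le> z" "z \<le> 1" "{y..z} \<inter> A (m (Suc i)) = {}" for y z
    proof -
      have "integral {y..z} (H (Suc i + k)) = 0" for k
        by (rule integral_eq_0) (use yz H_zero in blast)
      then have "\<forall>\<^sub>F j in sequentially. integral {y..z} (H j) = 0"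
        unfolding eventually_sequentially by (metis le_Suc_ex)
      moreover have "(\<lambda>j. integral {y..z} (H j)) \<longlonglongrightarrow> F z - F y"
        unfolding integral_0_diff[OF contH yz(1-3)] using yz by (intro tendsto_diff F_lim) auto
      ultimately have "F z - F y = 0"
        by (metis tendsto_eventually LIMSEQ_unique)
      then show ?thesis by simp
    qed
    show ?thesis
    proof (cases "x = 1")
      case True
      then show ?thesis by force
    next
      case False
      have "open (- A (m (Suc i)))" using clos by (simp add: open_closed)
      then obtain e where e: "e > 0" "ball x e \<subseteq> - A (m (Suc i))"
        using x by (auto simp: open_contains_ball)
      have "x < min 1 (x + e)" using False x(1) e(1) by simp
      then obtain r where r: "r \<in> \<rat>" "x < r" "r < min 1 (x + e)" using Rats_dense_in_real by blast
      have "{x..r} \<subseteq> ball x e" using r by (auto simp: dist_real_def)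
      then have "F x = F r" using e(2) x(1) r by (intro F_eq) auto
      then show ?thesis using r x by auto
    qed
  qed
  \<comment> \<open>The first factor is \<open>h (m 1)\<close>, because \<open>H 0\<close> is constant.\<close>
  define X where "X = {y \<in> {0..1}. \<forall>i. y \<in> A (m (Suc i))} - D"
  have X_sub: "X \<subseteq> E"
  proof
    fix y assume y: "y \<in> X"
    have "infinite {n. y \<in> A n}"
    proof (rule infinite_super)
      show "range (\<lambda>i. m (Suc i)) \<subseteq> {n. y \<in> A n}" using y by (auto simp: X_def)
      have "inj (\<lambda>i. m (Suc i))"
        using m_mono by (auto simp: inj_on_def strict_mono_eq)
      then show "infinite (range (\<lambda>i. m (Suc i)))" by (rule range_inj_infinite)
    qed
    then show "y \<in> E" using y E by (auto simp: X_def)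
  qed
  have "\<not> negligible (F ` X)"
  proof
    assume neg: "negligible (F ` X)"
    have "{0..1/2} \<subseteq> F ` X \<union> F ` (\<rat> \<inter> {0..1}) \<union> F ` D"
    proof
      fix v :: real assume "v \<in> {0..1/2}"
      then obtain x where "0 \<le> x" "x \<le> 1" "F x = v"
        using IVT'[of F 0 v 1] F0 F1 F_cont by auto
      then show "v \<in> F ` X \<union> F ` (\<rat> \<inter> {0..1}) \<union> F ` D"
        using F_const[of x] by (cases "\<forall>i. x \<in> A (m (Suc i))") (auto simp: X_def)
    qed
    moreover have negl_countable: "negligible S" if "countable S" for S :: "real set"
      unfolding negligible_iff_null_sets
      by (intro null_sets_completionI countable_imp_null_set_lborel that)
    then have "negligible (F ` (\<rat> \<inter> {0..1}))" "negligible (F ` D)"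
      using D countable_rat
      by (auto intro!: negl_countable countable_image countable_Int1)
    ultimately have "negligible {0..1/2::real}"
      using neg by (meson negligible_Un negligible_subset)
    then show False by (simp add: negligible_interval(1)[where 'a = real, unfolded cbox_interval box_real])
  qed
  then have "ereal s \<le> hausdorff_dim X"
    by (intro hausdorff_dim_ge_Hoelder[where K = 2 and F = F] F_hoelder) (auto simp: X_def)
  also have "\<dots> \<le> hausdorff_dim E"
    unfolding hausdorff_dim_def
    by (intro Inf_superset_mono) (use X_sub hausdorff_measure_mono_null in blast)
  finally show ?thesis .
qed

section \<open>Visits of an irrational rotation to an interval\<close>

lemma dist_int_le: "dist_int x \<le> \<bar>x - of_int m\<bar>"
  unfolding dist_int_def using infdist_le[of "of_int m" \<int> x] by (simp add: dist_real_def)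

lemma dist_int_nonneg: "0 \<le> dist_int x"
  by (simp add: dist_int_def infdist_nonneg)

lemma dist_int_nearest:
  obtains m :: int where "dist_int x = \<bar>x - of_int m\<bar>"
proof -
  obtain z :: real where "z \<in> \<int>" "infdist x \<int> = dist x z"
    using infdist_attains_inf[of "\<int> :: real set" x] closed_Ints by blast
  then show ?thesis using that by (auto simp: dist_int_def dist_real_def elim!: Ints_cases)
qed

lemma dist_int_minus: "dist_int (- x) = dist_int x"
proof -
  have *: "dist_int (- y) \<le> dist_int y" for y
  proof -
    obtain m where "dist_int y = \<bar>y - of_int m\<bar>" by (rule dist_int_nearest)
    then show ?thesis using dist_int_le[of "- y" "- m"] by simp
  qed
  show ?thesis using *[of x] *[of "- x"] by simp
qed

lemma dist_int_pos_irrational: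
  assumes "\<alpha> \<notin> \<rat>" "n \<ge> 1"
  shows "0 < dist_int (real n * \<alpha>)"
proof (rule ccontr)
  assume "\<not> 0 < dist_int (real n * \<alpha>)"
  then have "dist_int (real n * \<alpha>) = 0" using dist_int_nonneg[of "real n * \<alpha>"] by simp
  moreover obtain m where "dist_int (real n * \<alpha>) = \<bar>real n * \<alpha> - of_int m\<bar>"
    by (rule dist_int_nearest)
  ultimately have "\<alpha> = of_int m / of_nat n" using assms(2) by (simp add: field_simps)
  then have "\<alpha> \<in> \<rat>" by (metis Rats_divide Rats_of_int Rats_of_nat)
  with assms(1) show False by simp
qed

text \<open>
  Points that are pairwise \<open>\<sigma>\<close>-separated modulo 1 have \<open>\<sigma>\<close>-separated representatives near \<open>c\<close>, so
  the cells of length \<open>\<sigma>\<close> in which they lie are distinct.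
\<close>

lemma card_separated_le:
  assumes fin: "finite I" and \<sigma>: "\<sigma> > 0" and \<rho>: "\<rho> \<ge> 0"
    and near: "\<And>i. i \<in> I \<Longrightarrow> dist_int (c - x i) \<le> \<rho>"
    and sep: "\<And>i j. i \<in> I \<Longrightarrow> j \<in> I \<Longrightarrow> i \<noteq> j \<Longrightarrow> \<sigma> \<le> dist_int (x i - x j)"
  shows "real (card I) \<le> 2 * \<rho> / \<sigma> + 1"
proof -
  have "\<exists>m :: int. \<bar>c - x i - of_int m\<bar> \<le> \<rho>" if "i \<in> I" for i
    using near[OF that] dist_int_nearest[of "c - x i"] by metis
  then obtain m :: "_ \<Rightarrow> int" where m: "\<And>i. i \<in> I \<Longrightarrow> \<bar>c - x i - of_int (m i)\<bar> \<le> \<rho>" by metis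
  define e where "e i = c - x i - of_int (m i)" for i
  define g where "g i = \<lfloor>(e i + \<rho>) / \<sigma>\<rfloor>" for i
  have "inj_on g I"
  proof (rule inj_onI, rule ccontr)
    fix i j assume ij: "i \<in> I" "j \<in> I" "g i = g j" "i \<noteq> j"
    have "\<bar>(e i + \<rho>) / \<sigma> - (e j + \<rho>) / \<sigma>\<bar> < 1"
      using ij(3) unfolding g_def by linarith
    then have "\<bar>e j - e i\<bar> < \<sigma>"
      using \<sigma> by (simp add: diff_divide_distrib[symmetric] abs_divide abs_minus_commute)
    moreover have "e j - e i = (x i - x j) - of_int (m j - m i)" by (simp add: e_def)
    ultimately show False
      using sep[OF ij(1,2,4)] dist_int_le[of "x i - x j" "m j - m i"] by simp
  qed
  moreover have "g ` I \<subseteq> {0..\<lfloor>2 * \<rho> / \<sigma>\<rfloor>}"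
  proof
    fix z assume "z \<in> g ` I"
    then obtain i where i: "i \<in> I" "z = g i" by blast
    have "0 \<le> (e i + \<rho>) / \<sigma>" "(e i + \<rho>) / \<sigma> \<le> 2 * \<rho> / \<sigma>"
      using m[OF i(1)] \<sigma> by (auto simp: e_def intro!: divide_right_mono divide_nonneg_pos)
    then show "z \<in> {0..\<lfloor>2 * \<rho> / \<sigma>\<rfloor>}" by (auto simp: i(2) g_def intro: floor_mono)
  qed
  ultimately have "card I \<le> card {0..\<lfloor>2 * \<rho> / \<sigma>\<rfloor>}"
    by (metis card_image card_mono finite_atLeastAtMost_int)
  also have "\<dots> = nat (\<lfloor>2 * \<rho> / \<sigma>\<rfloor> + 1)" by simp
  finally have "int (card I) \<le> \<lfloor>2 * \<rho> / \<sigma>\<rfloor> + 1"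
    using \<rho> \<sigma> by (simp add: nat_le_iff le_nat_iff)
  then show ?thesis by linarith
qed

text \<open>
  The number of visits of the orbit \<open>\<alpha>, 2 \<alpha>, \<dots>, N \<alpha>\<close> modulo 1 to the closed interval of centre \<open>c\<close>
  and radius \<open>\<rho>\<close>.
\<close>

definition visits :: "real \<Rightarrow> nat \<Rightarrow> real \<Rightarrow> real \<Rightarrow> nat" where
  "visits \<alpha> N c \<rho> = card {n \<in> {1..N}. dist_int (c - real n * \<alpha>) \<le> \<rho>}"

lemma visits_le: "visits \<alpha> N c \<rho> \<le> N"
proof -
  have "visits \<alpha> N c \<rho> \<le> card {1..N}" unfolding visits_def by (intro card_mono) auto
  then show ?thesis by simp
qed

lemma visits_le_gap:
  assumes "\<delta> > 0" "\<rho> \<ge> 0" and gap: "\<And>d. d \<in> {1..N} \<Longrightarrow> \<delta> \<le> dist_int (real d * \<alpha>)"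
  shows "real (visits \<alpha> N c \<rho>) \<le> 2 * \<rho> / \<delta> + 1"
  unfolding visits_def
proof (rule card_separated_le[where x = "\<lambda>n. real n * \<alpha>" and c = c])
  fix i j assume ij: "i \<in> {n \<in> {1..N}. dist_int (c - real n * \<alpha>) \<le> \<rho>}"
    "j \<in> {n \<in> {1..N}. dist_int (c - real n * \<alpha>) \<le> \<rho>}" "i \<noteq> j"
  show "\<delta> \<le> dist_int (real i * \<alpha> - real j * \<alpha>)"
  proof (cases "j < i")
    case True
    then have "real i * \<alpha> - real j * \<alpha> = real (i - j) * \<alpha>" by (simp add: of_nat_diff algebra_simps)
    then show ?thesis by (simp only:) (rule gap, use ij True in auto)
  next
    case False
    then have "real i * \<alpha> - real j * \<alpha> = - (real (j - i) * \<alpha>)" by (simp add: of_nat_diff algebra_simps)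
    then show ?thesis by (simp only: dist_int_minus) (rule gap, use ij False in auto)
  qed
qed (use assms in auto)

text \<open>
  Best approximation denominators: no smaller positive multiple of \<open>\<alpha>\<close> is closer to the integers.
  Those of an irrational number are the denominators of its continued fraction convergents.
\<close>

definition best_denominator :: "real \<Rightarrow> nat \<Rightarrow> bool" where
  "best_denominator \<alpha> q \<longleftrightarrow> 1 \<le> q \<and> (\<forall>d\<in>{1..q}. dist_int (real q * \<alpha>) \<le> dist_int (real d * \<alpha>))"

lemma best_denominator_up_to:
  assumes "N \<ge> 1"
  obtains q where "q \<in> {1..N}" "best_denominator \<alpha> q"
    "\<And>d. d \<in> {1..N} \<Longrightarrow> dist_int (real q * \<alpha>) \<le> dist_int (real d * \<alpha>)"
proof -
  let ?q = "arg_min_on (\<lambda>d. dist_int (real d * \<alpha>)) {1..N}"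
  have q: "?q \<in> {1..N}" using assms by (intro arg_min_if_finite) auto
  moreover have *: "dist_int (real ?q * \<alpha>) \<le> dist_int (real d * \<alpha>)" if "d \<in> {1..N}" for d
    by (rule arg_min_least) (use that in auto)
  ultimately show ?thesis using that[OF q _ *] by (auto simp: best_denominator_def)
qed

lemma dist_int_Dirichlet:
  assumes "N \<ge> 1"
  obtains k where "k \<in> {1..N}" "dist_int (real k * \<alpha>) < 1 / real N"
proof -
  obtain h k :: int where hk: "0 < k" "k \<le> int N" "\<bar>of_int k * \<alpha> - of_int h\<bar> < 1 / real N"
    by (rule Dirichlet_approx[of N \<alpha>]) (use assms in linarith)
  have "dist_int (real (nat k) * \<alpha>) < 1 / real N"
    using dist_int_le[of "real (nat k) * \<alpha>" h] hk by simp
  moreover have "nat k \<in> {1..N}" using hk by auto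
  ultimately show ?thesis by (rule that[rotated])
qed

text \<open>
  The least multiple that beats all multiples up to \<open>M\<close> is best; it exists by Dirichlet's theorem.
\<close>

lemma infinitely_many_best_denominators:
  assumes "\<alpha> \<notin> \<rat>"
  obtains q where "M \<le> q" "best_denominator \<alpha> q"
proof -
  obtain q0 where q0: "q0 \<in> {1..max 1 M}" "best_denominator \<alpha> q0"
    "\<And>d. d \<in> {1..max 1 M} \<Longrightarrow> dist_int (real q0 * \<alpha>) \<le> dist_int (real d * \<alpha>)"
    by (rule best_denominator_up_to[of "max 1 M" \<alpha>]) auto
  let ?\<delta> = "dist_int (real q0 * \<alpha>)"
  have "?\<delta> > 0" using q0(1) assms by (intro dist_int_pos_irrational) auto
  then obtain N where N: "N \<ge> 1" "1 / real N < ?\<delta>"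
    using ex_inverse_of_nat_less[of ?\<delta>] by (auto simp: inverse_eq_divide Suc_le_eq)
  obtain k0 where "k0 \<in> {1..N}" "dist_int (real k0 * \<alpha>) < 1 / real N"
    by (rule dist_int_Dirichlet[OF N(1)])
  then have ex: "1 \<le> k0 \<and> dist_int (real k0 * \<alpha>) < ?\<delta>" using N(2) by auto
  define k where "k = (LEAST k. 1 \<le> k \<and> dist_int (real k * \<alpha>) < ?\<delta>)"
  have k: "1 \<le> k" "dist_int (real k * \<alpha>) < ?\<delta>"
    using LeastI[of "\<lambda>k. 1 \<le> k \<and> dist_int (real k * \<alpha>) < ?\<delta>", OF ex] by (auto simp: k_def)
  have least: "?\<delta> \<le> dist_int (real d * \<alpha>)" if "1 \<le> d" "d < k" for d
    using not_less_Least[of d "\<lambda>k. 1 \<le> k \<and> dist_int (real k * \<alpha>) < ?\<delta>"] that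
    by (auto simp: k_def)
  have "M \<le> k"
  proof (rule ccontr)
    assume "\<not> M \<le> k"
    then have "?\<delta> \<le> dist_int (real k * \<alpha>)" using k(1) by (intro q0(3)) auto
    with k(2) show False by simp
  qed
  moreover have "best_denominator \<alpha> k"
    unfolding best_denominator_def
  proof (intro conjI ballI)
    fix d assume "d \<in> {1..k}"
    then show "dist_int (real k * \<alpha>) \<le> dist_int (real d * \<alpha>)"
      using least[of d] k(2) by (cases "d = k") auto
  qed (use k in auto)
  ultimately show ?thesis by (rule that)
qed

text \<open>
  The second conclusion says that \<open>p\<close> and \<open>q\<close> are coprime, in the form in which it is needed: the
  multiples of \<open>p / q\<close> with distinct factors below \<open>q\<close> are distinct modulo 1. If it failed for \<open>d\<close>,
  then \<open>p / q\<close> would have the denominator \<open>\<bar>d\<bar>\<close>, and \<open>\<bar>d\<bar> \<alpha>\<close> would be closer to the integers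
  than \<open>q \<alpha>\<close>.
\<close>

lemma best_denominator_rational:
  assumes irr: "\<alpha> \<notin> \<rat>" and best: "best_denominator \<alpha> q"
  obtains p :: int where "\<bar>real q * \<alpha> - of_int p\<bar> \<le> 1 / real q"
    "\<And>d. 0 < \<bar>d\<bar> \<Longrightarrow> \<bar>d\<bar> < int q \<Longrightarrow> \<not> int q dvd d * p"
proof -
  have q: "q \<ge> 1" using best by (simp add: best_denominator_def)
  obtain p where p: "dist_int (real q * \<alpha>) = \<bar>real q * \<alpha> - of_int p\<bar>" by (rule dist_int_nearest)
  obtain k where "k \<in> {1..q}" "dist_int (real k * \<alpha>) < 1 / real q" by (rule dist_int_Dirichlet[OF q])
  then have "\<bar>real q * \<alpha> - of_int p\<bar> \<le> 1 / real q"
    using best p by (force simp: best_denominator_def)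
  moreover have "\<not> int q dvd d * p" if d: "0 < \<bar>d\<bar>" "\<bar>d\<bar> < int q" for d
  proof
    assume "int q dvd d * p"
    then have "int q dvd \<bar>d\<bar> * p" by (simp add: abs_if)
    then obtain m where "\<bar>d\<bar> * p = int q * m" by (auto simp: dvd_def)
    then have m: "real_of_int \<bar>d\<bar> * of_int p = real q * of_int m"
      by (metis of_int_mult of_int_of_nat_eq)
    define e where "e = nat \<bar>d\<bar>"
    have e: "real e = real_of_int \<bar>d\<bar>" "e \<in> {1..q}" "e < q" using d by (auto simp: e_def)
    have "real q * (real e * \<alpha> - of_int m) = real e * (real q * \<alpha> - of_int p)"
      using m e(1) by (simp add: algebra_simps)
    then have "real q * \<bar>real e * \<alpha> - of_int m\<bar> = real e * dist_int (real q * \<alpha>)"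
      unfolding p by (metis abs_mult abs_of_nat)
    moreover have "dist_int (real q * \<alpha>) \<le> dist_int (real e * \<alpha>)"
      using best e(2) by (simp add: best_denominator_def)
    moreover have "dist_int (real e * \<alpha>) \<le> \<bar>real e * \<alpha> - of_int m\<bar>" by (rule dist_int_le)
    ultimately have "real q * dist_int (real q * \<alpha>) \<le> real e * dist_int (real q * \<alpha>)"
      by (metis mult_left_mono of_nat_0_le_iff order_trans)
    then show False using dist_int_pos_irrational[OF irr q] e(3) by simp
  qed
  ultimately show ?thesis by (rule that)
qed

text \<open>
  On \<open>q\<close> consecutive indices, \<open>n \<alpha>\<close> differs from the grid point \<open>x n\<close> of the proof by at most
  \<open>1 / q\<close>, and the grid has mesh \<open>1 / q\<close>.
\<close>

lemma visits_block_le: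
  assumes irr: "\<alpha> \<notin> \<rat>" and best: "best_denominator \<alpha> q" and \<rho>: "\<rho> \<ge> 0"
  shows "real (card {n \<in> {a..<a + q}. dist_int (c - real n * \<alpha>) \<le> \<rho>}) \<le> 2 * \<rho> * real q + 3"
proof -
  have q: "real q > 0" using best by (simp add: best_denominator_def)
  obtain p where p: "\<bar>real q * \<alpha> - of_int p\<bar> \<le> 1 / real q"
    "\<And>d. 0 < \<bar>d\<bar> \<Longrightarrow> \<bar>d\<bar> < int q \<Longrightarrow> \<not> int q dvd d * p"
    using best_denominator_rational[OF irr best] by metis
  define x where "x n = real a * (\<alpha> - of_int p / real q) + real n * (of_int p / real q)" for n
  have near: "dist_int (c - x n) \<le> \<rho> + 1 / real q"
    if n: "n \<in> {a..<a + q}" "dist_int (c - real n * \<alpha>) \<le> \<rho>" for n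
  proof -
    have "real n * \<alpha> - x n = (real n - real a) / real q * (real q * \<alpha> - of_int p)"
      using q by (simp add: x_def field_simps)
    then have "\<bar>real n * \<alpha> - x n\<bar> = (real n - real a) / real q * \<bar>real q * \<alpha> - of_int p\<bar>"
      using n(1) q by (simp add: abs_mult)
    also have "\<dots> \<le> 1 * (1 / real q)" using n(1) q p(1) by (intro mult_mono) auto
    finally have "\<bar>real n * \<alpha> - x n\<bar> \<le> 1 / real q" by simp
    moreover obtain m where "dist_int (c - real n * \<alpha>) = \<bar>c - real n * \<alpha> - of_int m\<bar>"
      by (rule dist_int_nearest)
    ultimately show ?thesis using n(2) dist_int_le[of "c - x n" m] by linarith
  qed
  have "real (card {n \<in> {a..<a + q}. dist_int (c - real n * \<alpha>) \<le> \<rho>})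
     \<le> 2 * (\<rho> + 1 / real q) / (1 / real q) + 1"
  proof (rule card_separated_le[where x = x and c = c])
    fix i j assume ij: "i \<in> {n \<in> {a..<a + q}. dist_int (c - real n * \<alpha>) \<le> \<rho>}"
      "j \<in> {n \<in> {a..<a + q}. dist_int (c - real n * \<alpha>) \<le> \<rho>}" "i \<noteq> j"
    obtain m where m: "dist_int (x i - x j) = \<bar>x i - x j - of_int m\<bar>" by (rule dist_int_nearest)
    have "x i - x j - of_int m = of_int ((int i - int j) * p - int q * m) / real q"
      using q by (simp add: x_def field_simps)
    moreover have "(int i - int j) * p - int q * m \<noteq> 0"
    proof
      assume "(int i - int j) * p - int q * m = 0"
      then have "int q dvd (int i - int j) * p" by (simp add: dvd_def)
      moreover have "a \<le> i" "i < a + q" "a \<le> j" "j < a + q" using ij by simp_all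
      then have "\<bar>int i - int j\<bar> < int q" "0 < \<bar>int i - int j\<bar>" using ij(3) by linarith+
      ultimately show False using p(2) by blast
    qed
    then have "1 \<le> \<bar>real_of_int ((int i - int j) * p - int q * m)\<bar>" by linarith
    ultimately show "1 / real q \<le> dist_int (x i - x j)"
      unfolding m using q by (simp add: abs_divide divide_right_mono)
  qed (use near q \<rho> in auto)
  also have "\<dots> = 2 * \<rho> * real q + 3" using q by (simp add: field_simps)
  finally show ?thesis .
qed

lemma visits_le_blocks:
  assumes irr: "\<alpha> \<notin> \<rat>" and best: "best_denominator \<alpha> q" and \<rho>: "\<rho> \<ge> 0"
  shows "real (visits \<alpha> N c \<rho>) \<le> (real N / real q + 1) * (2 * \<rho> * real q + 3)"
proof -
  have q: "q > 0" using best by (simp add: best_denominator_def)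
  let ?B = "\<lambda>k. {n \<in> {k * q..<k * q + q}. dist_int (c - real n * \<alpha>) \<le> \<rho>}"
  have "{n \<in> {1..N}. dist_int (c - real n * \<alpha>) \<le> \<rho>} \<subseteq> (\<Union>k\<in>{..N div q}. ?B k)"
  proof
    fix n assume n: "n \<in> {n \<in> {1..N}. dist_int (c - real n * \<alpha>) \<le> \<rho>}"
    have "n div q * q + n mod q = n" by (rule div_mult_mod_eq)
    moreover have "n mod q < q" using q by simp
    ultimately have "n div q * q \<le> n" "n < n div q * q + q" by linarith+
    then have "n \<in> ?B (n div q)" using n by simp
    moreover have "n div q \<in> {..N div q}" using n by (simp add: div_le_mono)
    ultimately show "n \<in> (\<Union>k\<in>{..N div q}. ?B k)" by (rule UN_I[rotated])
  qed
  then have "visits \<alpha> N c \<rho> \<le> card (\<Union>k\<in>{..N div q}. ?B k)"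
    unfolding visits_def by (intro card_mono) auto
  also have "\<dots> \<le> (\<Sum>k\<le>N div q. card (?B k))" by (rule card_UN_le) simp
  finally have "real (visits \<alpha> N c \<rho>) \<le> (\<Sum>k\<le>N div q. real (card (?B k)))"
    unfolding of_nat_sum[symmetric] by (simp only: of_nat_le_iff)
  also have "\<dots> \<le> (\<Sum>k\<le>N div q. 2 * \<rho> * real q + 3)"
    by (intro sum_mono visits_block_le irr best \<rho>)
  also have "\<dots> = (real (N div q) + 1) * (2 * \<rho> * real q + 3)" by simp
  also have "\<dots> \<le> (real N / real q + 1) * (2 * \<rho> * real q + 3)"
    using \<rho> by (intro mult_right_mono add_right_mono of_nat_div_le_of_nat) auto
  finally show ?thesis .
qed

text \<open>
  The upper half of equidistribution, uniformly in the interval. The lower half for densities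
  follows because their total mass is 1.
\<close>

lemma visits_equidistributed:
  assumes irr: "\<alpha> \<notin> \<rat>" and \<epsilon>: "\<epsilon> > 0"
  shows "\<forall>\<^sub>F N in sequentially. \<forall>c. \<forall>\<rho>\<in>{0..1}. real (visits \<alpha> N c \<rho>) \<le> (2 * \<rho> + \<epsilon>) * real N"
proof -
  \<comment> \<open>A fixed best denominator \<open>q\<close> with \<open>3 / q\<close> small serves all large \<open>N\<close>: each block of length \<open>q\<close>
     contributes at most 3 visits in excess of the expected number.\<close>
  obtain M where M: "6 / \<epsilon> < real M" using reals_Archimedean2 by blast
  obtain q where q: "M \<le> q" "best_denominator \<alpha> q"
    by (rule infinitely_many_best_denominators[OF irr])
  have q0: "real q > 0" using q(2) by (simp add: best_denominator_def)
  have q\<epsilon>: "3 / real q \<le> \<epsilon> / 2"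
  proof -
    have "6 / \<epsilon> \<le> real q" using M q(1) by linarith
    then show ?thesis using \<epsilon> q0 by (simp add: field_simps)
  qed
  obtain N0 where N0: "(2 * real q + 3) / (\<epsilon> / 2) < real N0" using reals_Archimedean2 by blast
  show ?thesis
    unfolding eventually_sequentially
  proof (intro exI allI impI ballI)
    fix N c \<rho> assume N: "N0 \<le> N" and \<rho>: "\<rho> \<in> {0..1::real}"
    have "(2 * real q + 3) / (\<epsilon> / 2) \<le> real N" using N0 N by linarith
    then have N1: "2 * real q + 3 \<le> \<epsilon> / 2 * real N" using \<epsilon> by (simp add: field_simps)
    have "real (visits \<alpha> N c \<rho>) \<le> (real N / real q + 1) * (2 * \<rho> * real q + 3)"
      using visits_le_blocks[OF irr q(2)] \<rho> by simp
    also have "\<dots> = 2 * \<rho> * real N + real N * (3 / real q) + (2 * \<rho> * real q + 3)"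
      using q0 by (simp add: field_simps)
    also have "\<dots> \<le> 2 * \<rho> * real N + real N * (\<epsilon> / 2) + (2 * 1 * real q + 3)"
      using \<rho> q\<epsilon> by (intro add_mono mult_left_mono mult_right_mono) auto
    also have "\<dots> \<le> (2 * \<rho> + \<epsilon>) * real N" using N1 by (simp add: algebra_simps)
    finally show "real (visits \<alpha> N c \<rho>) \<le> (2 * \<rho> + \<epsilon>) * real N" .
  qed
qed

text \<open>
  The block bound suffices for \<open>\<rho>\<^sup>t \<ge> 1 / q\<close>. Below that scale the separation by
  \<open>dist_int (q \<alpha>)\<close> is used, unless \<open>r\<^sup>t \<ge> 1 / q\<close>, when such \<open>\<rho>\<close> do not occur.
\<close>

lemma visits_le_powr:
  assumes irr: "\<alpha> \<notin> \<rat>" and best: "best_denominator \<alpha> q" and qN: "q \<le> N"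
    and gap: "\<And>d. d \<in> {1..N} \<Longrightarrow> dist_int (real q * \<alpha>) \<le> dist_int (real d * \<alpha>)"
    and t: "0 < t" "t \<le> 1" and r: "r > 0" and Nr: "1 \<le> real N * r powr t"
    and C: "C \<ge> 0"
    and scale: "1 / real q \<le> r powr t \<or>
      1 / dist_int (real q * \<alpha>) \<le> C * real N * real q powr (1 / t - 1)"
    and \<rho>: "r \<le> \<rho>"
  shows "real (visits \<alpha> N c \<rho>) \<le> (10 + 2 * C) * real N * \<rho> powr t"
proof -
  have q: "real q \<ge> 1" using best by (simp add: best_denominator_def)
  have \<rho>0: "\<rho> > 0" using r \<rho> by simp
  have qN': "real q \<le> real N" using qN by simp
  have mono: "a * real N * \<rho> powr t \<le> (10 + 2 * C) * real N * \<rho> powr t" if "a \<le> 10 + 2 * C" for a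
    using that by (intro mult_right_mono) auto
  consider "1 \<le> \<rho>" | "\<rho> < 1" "1 / real q \<le> \<rho> powr t" | "\<rho> < 1" "\<rho> powr t < 1 / real q" by linarith
  then show ?thesis
  proof cases
    case 1
    have "1 \<le> \<rho> powr t" using 1 t by (intro ge_one_powr_ge_zero) auto
    then have "real N * 1 \<le> real N * \<rho> powr t" by (intro mult_left_mono) auto
    then have "real (visits \<alpha> N c \<rho>) \<le> 1 * real N * \<rho> powr t"
      using visits_le[of \<alpha> N c \<rho>] by (simp add: order_trans[OF of_nat_mono])
    then show ?thesis using mono[of 1] C by linarith
  next
    case 2
    have \<rho>t: "\<rho> \<le> \<rho> powr t" using 2 \<rho>0 t powr_mono'[of t 1 \<rho>] by simp
    have "real (visits \<alpha> N c \<rho>) \<le> (real N / real q + 1) * (2 * \<rho> * real q + 3)"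
      using visits_le_blocks[OF irr best] \<rho>0 by simp
    also have "\<dots> \<le> (2 * real N / real q) * (2 * \<rho> * real q + 3)"
      using q qN' \<rho>0 by (intro mult_right_mono) (auto simp: field_simps)
    also have "\<dots> = 4 * real N * \<rho> + 6 * real N * (1 / real q)"
      using q by (simp add: field_simps)
    also have "\<dots> \<le> 4 * real N * \<rho> powr t + 6 * real N * \<rho> powr t"
      using 2 \<rho>t by (intro add_mono mult_left_mono) auto
    also have "\<dots> = 10 * real N * \<rho> powr t" by simp
    finally show ?thesis using mono[of 10] C by linarith
  next
    case 3
    have \<delta>: "dist_int (real q * \<alpha>) > 0" using q irr by (intro dist_int_pos_irrational) auto
    have "r powr t \<le> \<rho> powr t" using r \<rho> t by (intro powr_mono2) auto
    then have sc: "1 / dist_int (real q * \<alpha>) \<le> C * real N * real q powr (1 / t - 1)"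
      using scale 3 by linarith
    have "real q \<le> \<rho> powr (- t)" using 3 q \<rho>0 by (simp add: powr_minus field_simps)
    then have "real q powr (1 / t - 1) \<le> (\<rho> powr (- t)) powr (1 / t - 1)"
      using q t by (intro powr_mono2) (auto simp: field_simps)
    also have "\<dots> = \<rho> powr (- t * (1 / t - 1))" by (simp add: powr_powr)
    also have "- t * (1 / t - 1) = t - 1" using t by (simp add: right_diff_distrib)
    finally have *: "real q powr (1 / t - 1) \<le> \<rho> powr (t - 1)" .
    have "real (visits \<alpha> N c \<rho>) \<le> 2 * \<rho> / dist_int (real q * \<alpha>) + 1"
      using \<delta> \<rho>0 gap by (intro visits_le_gap) auto
    also have "\<dots> = 2 * \<rho> * (1 / dist_int (real q * \<alpha>)) + 1" by simp
    also have "\<dots> \<le> 2 * \<rho> * (C * real N * real q powr (1 / t - 1)) + real N * r powr t"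
      using sc \<rho>0 Nr by (intro add_mono mult_left_mono) auto
    also have "\<dots> \<le> 2 * \<rho> * (C * real N * \<rho> powr (t - 1)) + real N * \<rho> powr t"
      using * \<rho>0 C r \<rho> t by (intro add_mono mult_left_mono powr_mono2) auto
    also have "\<dots> = 2 * C * real N * (\<rho> powr 1 * \<rho> powr (t - 1)) + real N * \<rho> powr t"
      using \<rho>0 by simp
    also have "\<dots> = (2 * C + 1) * real N * \<rho> powr t"
      unfolding powr_add[symmetric] by (simp add: algebra_simps)
    finally show ?thesis using mono[of "2 * C + 1"] by linarith
  qed
qed

section \<open>Densities concentrated near the orbit\<close>

text \<open>
  The parabolic bump with support \<open>[-r, r]\<close>, normalised to have integral 1.
\<close>

definition bump :: "real \<Rightarrow> real \<Rightarrow> real" where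
  "bump r z = 3 / (4 * r ^ 3) * max 0 (r\<^sup>2 - z\<^sup>2)"

lemma bump_nonneg: "r > 0 \<Longrightarrow> 0 \<le> bump r z"
  by (simp add: bump_def)

lemma bump_eq_0:
  assumes "r \<le> \<bar>z\<bar>" "0 < r"
  shows "bump r z = 0"
proof -
  have "r\<^sup>2 \<le> \<bar>z\<bar>\<^sup>2" using assms by (intro power_mono) auto
  then have "max 0 (r\<^sup>2 - z\<^sup>2) = 0" by simp
  then show ?thesis unfolding bump_def by (simp only: mult_zero_right)
qed

lemma bump_le:
  assumes r: "r > 0"
  shows "bump r z \<le> 1 / r"
proof -
  have "max 0 (r\<^sup>2 - z\<^sup>2) \<le> r\<^sup>2" by simp
  then have "bump r z \<le> 3 / (4 * r ^ 3) * r\<^sup>2"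
    unfolding bump_def using r by (intro mult_left_mono) auto
  also have "\<dots> = 3 / 4 / r" using r by (simp add: power2_eq_square power3_eq_cube)
  also have "\<dots> \<le> 1 / r" using r by (intro divide_right_mono) auto
  finally show ?thesis .
qed

lemma continuous_on_bump [continuous_intros]:
  "continuous_on S f \<Longrightarrow> continuous_on S (\<lambda>z. bump r (f z))"
  unfolding bump_def by (intro continuous_intros)

lemma integral_bump_eq_1:
  assumes r: "r > 0" and "a \<le> x - r" "x + r \<le> b"
  shows "integral {a..b} (\<lambda>z. bump r (z - x)) = 1"
proof -
  let ?f = "\<lambda>z. bump r (z - x)"
  have int: "?f integrable_on {c..d}" for c d
    by (intro integrable_continuous_real continuous_intros)
  have "(?f has_integral (3 / (4 * r ^ 3) * (r\<^sup>2 * (x + r - x) - (x + r - x) ^ 3 / 3)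
      - 3 / (4 * r ^ 3) * (r\<^sup>2 * (x - r - x) - (x - r - x) ^ 3 / 3))) {x - r..x + r}"
  proof (rule fundamental_theorem_of_calculus)
    show "x - r \<le> x + r" using r by simp
    fix z assume "z \<in> {x - r..x + r}"
    then have "(z - x)\<^sup>2 \<le> r\<^sup>2" by (intro abs_le_square_iff[THEN iffD1]) auto
    then have *: "?f z = 3 / (4 * r ^ 3) * (r\<^sup>2 - (z - x)\<^sup>2)" by (simp add: bump_def)
    show "((\<lambda>z. 3 / (4 * r ^ 3) * (r\<^sup>2 * (z - x) - (z - x) ^ 3 / 3)) has_vector_derivative ?f z)
        (at z within {x - r..x + r})"
      unfolding * has_real_derivative_iff_has_vector_derivative[symmetric]
      by (rule derivative_eq_intros refl | simp)+
  qed
  also have "3 / (4 * r ^ 3) * (r\<^sup>2 * (x + r - x) - (x + r - x) ^ 3 / 3)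
      - 3 / (4 * r ^ 3) * (r\<^sup>2 * (x - r - x) - (x - r - x) ^ 3 / 3) = 1"
    using r by (simp add: power2_eq_square power3_eq_cube field_simps)
  finally have mid: "integral {x - r..x + r} ?f = 1" by (rule integral_unique)
  have "integral {a..x - r} ?f = 0" "integral {x + r..b} ?f = 0"
    by (rule integral_eq_0, rule bump_eq_0, use r in auto)+
  moreover have "integral {a..x - r} ?f + integral {x - r..x + r} ?f = integral {a..x + r} ?f"
    using assms by (intro Henstock_Kurzweil_Integration.integral_combine int) auto
  moreover have "integral {a..x + r} ?f + integral {x + r..b} ?f = integral {a..b} ?f"
    using assms by (intro Henstock_Kurzweil_Integration.integral_combine int) auto
  ultimately show ?thesis using mid by simp
qed

lemma integral_bump_le_1:
  assumes r: "r > 0"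
  shows "integral {a..b} (\<lambda>z. bump r (z - x)) \<le> 1"
proof -
  have int: "(\<lambda>z. bump r (z - x)) integrable_on {c..d}" for c d
    by (intro integrable_continuous_real continuous_intros)
  have "integral {a..b} (\<lambda>z. bump r (z - x)) \<le> integral {min a (x - r)..max b (x + r)} (\<lambda>z. bump r (z - x))"
    by (intro integral_subset_le int) (use r bump_nonneg in auto)
  also have "\<dots> = 1" by (intro integral_bump_eq_1 r) auto
  finally show ?thesis .
qed

text \<open>
  The average of the bumps about the first \<open>N\<close> orbit points, represented in \<open>[0, 1)\<close>. It is not made
  periodic: the mass outside \<open>[0, 1]\<close> is small for small \<open>r\<close> and large \<open>N\<close>, by
  equidistribution.
\<close>

definition orbit_density :: "real \<Rightarrow> nat \<Rightarrow> real \<Rightarrow> real \<Rightarrow> real" where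
  "orbit_density \<alpha> N r z = (\<Sum>n\<in>{1..N}. bump r (z - frac (real n * \<alpha>))) / real N"

lemma dist_int_le_frac: "dist_int (c - x) \<le> \<bar>c - frac x\<bar>"
  using dist_int_le[of "c - x" "- \<lfloor>x\<rfloor>"] by (simp add: frac_def algebra_simps)

lemma orbit_density_nonneg: "r > 0 \<Longrightarrow> 0 \<le> orbit_density \<alpha> N r z"
  by (simp add: orbit_density_def bump_nonneg sum_nonneg)

lemma continuous_on_orbit_density: "continuous_on S (orbit_density \<alpha> N r)"
  unfolding orbit_density_def divide_inverse by (intro continuous_intros)

lemma orbit_density_integrable: "orbit_density \<alpha> N r integrable_on {x..y}"
  by (intro integrable_continuous_real continuous_on_orbit_density)

lemma orbit_density_le:
  assumes r: "r > 0"
  shows "orbit_density \<alpha> N r z \<le> real (visits \<alpha> N z r) / (real N * r)"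
proof -
  let ?I = "{n \<in> {1..N}. dist_int (z - real n * \<alpha>) \<le> r}"
  have "(\<Sum>n\<in>{1..N}. bump r (z - frac (real n * \<alpha>))) = (\<Sum>n\<in>?I. bump r (z - frac (real n * \<alpha>)))"
  proof (rule sum.mono_neutral_right)
    show "\<forall>n\<in>{1..N} - ?I. bump r (z - frac (real n * \<alpha>)) = 0"
    proof
      fix n assume "n \<in> {1..N} - ?I"
      then have "r \<le> \<bar>z - frac (real n * \<alpha>)\<bar>" using dist_int_le_frac[of z "real n * \<alpha>"] by auto
      then show "bump r (z - frac (real n * \<alpha>)) = 0" using r by (rule bump_eq_0)
    qed
  qed auto
  also have "\<dots> \<le> (\<Sum>n\<in>?I. 1 / r)" using r by (intro sum_mono bump_le)
  also have "\<dots> = real (visits \<alpha> N z r) * (1 / r)" by (simp add: visits_def)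
  finally have "orbit_density \<alpha> N r z \<le> real (visits \<alpha> N z r) * (1 / r) / real N"
    unfolding orbit_density_def by (rule divide_right_mono) simp
  then show ?thesis by (simp add: mult.commute)
qed

lemma integral_orbit_density:
  "integral {x..y} (orbit_density \<alpha> N r) =
     (\<Sum>n\<in>{1..N}. integral {x..y} (\<lambda>z. bump r (z - frac (real n * \<alpha>)))) / real N"
proof -
  have "integral {x..y} (\<lambda>z. \<Sum>n\<in>{1..N}. bump r (z - frac (real n * \<alpha>))) =
     (\<Sum>n\<in>{1..N}. integral {x..y} (\<lambda>z. bump r (z - frac (real n * \<alpha>))))"
    by (intro integral_sum integrable_continuous_real continuous_intros) auto
  then show ?thesis unfolding orbit_density_def by simp
qed

lemma integral_orbit_density_le:
  assumes r: "r > 0"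
  shows "integral {x..y} (orbit_density \<alpha> N r)
    \<le> real (visits \<alpha> N ((x + y) / 2) ((y - x) / 2 + r)) / real N"
proof -
  let ?i = "\<lambda>n. integral {x..y} (\<lambda>z. bump r (z - frac (real n * \<alpha>)))"
  let ?I = "{n \<in> {1..N}. dist_int ((x + y) / 2 - real n * \<alpha>) \<le> (y - x) / 2 + r}"
  have "(\<Sum>n\<in>{1..N}. ?i n) = (\<Sum>n\<in>?I. ?i n)"
  proof (rule sum.mono_neutral_right)
    show "\<forall>n\<in>{1..N} - ?I. ?i n = 0"
    proof
      fix n assume "n \<in> {1..N} - ?I"
      then have far: "(y - x) / 2 + r < \<bar>(x + y) / 2 - frac (real n * \<alpha>)\<bar>"
        using dist_int_le_frac[of "(x + y) / 2" "real n * \<alpha>"] by auto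
      show "?i n = 0"
      proof (rule integral_eq_0)
        fix z assume "z \<in> {x..y}"
        then have "\<bar>(x + y) / 2 - z\<bar> \<le> (y - x) / 2"
          unfolding abs_le_iff by (intro conjI) (simp_all add: field_simps)
        then have "r \<le> \<bar>z - frac (real n * \<alpha>)\<bar>" using far by linarith
        then show "bump r (z - frac (real n * \<alpha>)) = 0" using r by (rule bump_eq_0)
      qed
    qed
  qed auto
  also have "\<dots> \<le> (\<Sum>n\<in>?I. 1)" using r by (intro sum_mono integral_bump_le_1)
  also have "\<dots> = real (visits \<alpha> N ((x + y) / 2) ((y - x) / 2 + r))" by (simp add: visits_def)
  finally show ?thesis unfolding integral_orbit_density by (rule divide_right_mono) simp
qed

lemma integral_orbit_density_total:
  assumes r: "r > 0" and N: "N \<ge> 1"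
  shows "integral {-r..1 + r} (orbit_density \<alpha> N r) = 1"
proof -
  have "integral {-r..1 + r} (\<lambda>z. bump r (z - frac (real n * \<alpha>))) = 1" for n
    using frac_ge_0[of "real n * \<alpha>"] frac_lt_1[of "real n * \<alpha>"] r
    by (intro integral_bump_eq_1) auto
  then show ?thesis unfolding integral_orbit_density using N by simp
qed

text \<open>
  The bound on visits gives \<open>\<integral>\<^sub>0\<^sup>x \<le> x + \<epsilon>\<close>. The lower bound follows by subtracting the upper
  bounds on \<open>[-r, 0]\<close> and \<open>[x, 1 + r]\<close> from the total mass.
\<close>

lemma orbit_density_equidistributed:
  assumes irr: "\<alpha> \<notin> \<rat>" and \<epsilon>: "\<epsilon> > 0"
  shows "\<forall>\<^sub>F N in sequentially. \<forall>r. 0 < r \<longrightarrow> r \<le> 1/8 \<longrightarrow> r \<le> \<epsilon> / 8 \<longrightarrow>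
    (\<forall>x\<in>{0..1}. \<bar>integral {0..x} (orbit_density \<alpha> N r) - x\<bar> \<le> \<epsilon>)"
proof -
  have "\<epsilon> / 8 > 0" using \<epsilon> by simp
  from visits_equidistributed[OF irr this] eventually_ge_at_top[of 1] show ?thesis
  proof eventually_elim
    case (elim N)
    show ?case
    proof (intro allI impI ballI)
      fix r x :: real
      assume r: "0 < r" "r \<le> 1/8" "r \<le> \<epsilon> / 8" and x: "x \<in> {0..1}"
      let ?g = "orbit_density \<alpha> N r"
      have N: "real N > 0" using elim(2) by simp
      have le: "integral {a..b} ?g \<le> b - a + 2 * r + \<epsilon> / 8"
        if "a \<le> b" "b - a \<le> 1 + r" for a b
      proof -
        have "(b - a) / 2 + r \<in> {0..1}" using that r by (simp add: field_simps)
        then have "real (visits \<alpha> N ((a + b) / 2) ((b - a) / 2 + r))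
            \<le> (2 * ((b - a) / 2 + r) + \<epsilon> / 8) * real N"
          using elim(1) by blast
        then have "real (visits \<alpha> N ((a + b) / 2) ((b - a) / 2 + r)) / real N
            \<le> 2 * ((b - a) / 2 + r) + \<epsilon> / 8"
          using N by (simp add: pos_divide_le_eq)
        also have "2 * ((b - a) / 2 + r) + \<epsilon> / 8 = b - a + 2 * r + \<epsilon> / 8"
          by (simp add: field_simps)
        finally show ?thesis
          using integral_orbit_density_le[OF r(1), of a b \<alpha> N] by linarith
      qed
      have "integral {-r..0} ?g + integral {0..1 + r} ?g = integral {-r..1 + r} ?g"
        by (rule Henstock_Kurzweil_Integration.integral_combine[OF _ _ orbit_density_integrable])
           (use r in linarith)+
      moreover have "integral {0..x} ?g + integral {x..1 + r} ?g = integral {0..1 + r} ?g"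
        by (rule Henstock_Kurzweil_Integration.integral_combine[OF _ _ orbit_density_integrable])
           (use r x in simp_all)
      ultimately have "integral {-r..0} ?g + integral {0..x} ?g + integral {x..1 + r} ?g = 1"
        using integral_orbit_density_total[OF r(1) elim(2), of \<alpha>] by linarith
      moreover have "integral {-r..0} ?g \<le> 0 - (-r) + 2 * r + \<epsilon> / 8"
        "integral {0..x} ?g \<le> x - 0 + 2 * r + \<epsilon> / 8"
        "integral {x..1 + r} ?g \<le> 1 + r - x + 2 * r + \<epsilon> / 8"
        by (rule le; use r x in simp)+
      ultimately show "\<bar>integral {0..x} ?g - x\<bar> \<le> \<epsilon>" using r by linarith
    qed
  qed
qed

lemma orbit_density_hoelder:
  assumes r: "r > 0" and N: "N \<ge> 1" and t: "0 < t" "t \<le> 1" and C: "C \<ge> 0"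
    and vis: "\<And>c \<rho>. r \<le> \<rho> \<Longrightarrow> real (visits \<alpha> N c \<rho>) \<le> C * real N * \<rho> powr t"
    and xy: "x \<le> y"
  shows "integral {x..y} (orbit_density \<alpha> N r) \<le> 2 * C * (y - x) powr t"
proof (cases "y - x \<le> r")
  case True
  have N0: "real N > 0" using N by simp
  have pt: "orbit_density \<alpha> N r z \<le> C * r powr (t - 1)" for z
  proof -
    have "orbit_density \<alpha> N r z \<le> real (visits \<alpha> N z r) / (real N * r)"
      by (rule orbit_density_le[OF r])
    also have "\<dots> \<le> C * real N * r powr t / (real N * r)"
      using vis[of r z] r by (intro divide_right_mono) auto
    also have "\<dots> = C * r powr (t - 1)"
      using N0 r by (simp add: powr_diff)
    finally show ?thesis .
  qed
  have "integral {x..y} (orbit_density \<alpha> N r) \<le> integral {x..y} (\<lambda>_. C * r powr (t - 1))"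
    by (intro integral_le orbit_density_integrable) (use pt in auto)
  also have "\<dots> = C * (r powr (t - 1) * (y - x))" using xy by simp
  also have "\<dots> \<le> C * (y - x) powr t"
  proof (cases "x = y")
    case False
    then have d: "y - x > 0" using xy by simp
    have "r powr (t - 1) \<le> (y - x) powr (t - 1)"
      using d True t by (intro powr_mono2') auto
    then have "r powr (t - 1) * (y - x) \<le> (y - x) powr (t - 1) * (y - x)"
      using d by (intro mult_right_mono) auto
    also have "\<dots> = (y - x) powr t" using d by (simp add: powr_diff)
    finally show ?thesis using C by (intro mult_left_mono) auto
  qed (simp add: C)
  also have "\<dots> \<le> 2 * C * (y - x) powr t" using C by (intro mult_right_mono) auto
  finally show ?thesis .
next
  case False
  have N0: "real N > 0" using N by simp
  have "integral {x..y} (orbit_density \<alpha> N r)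
      \<le> real (visits \<alpha> N ((x + y) / 2) ((y - x) / 2 + r)) / real N"
    by (rule integral_orbit_density_le[OF r])
  also have "\<dots> \<le> C * real N * ((y - x) / 2 + r) powr t / real N"
    using xy by (intro divide_right_mono vis) auto
  also have "\<dots> = C * ((y - x) / 2 + r) powr t" using N0 by simp
  also have "(y - x) / 2 + r \<le> 2 * (y - x)" using False r by (simp add: field_simps)
  then have "C * ((y - x) / 2 + r) powr t \<le> C * (2 * (y - x)) powr t"
    using r xy t C by (intro mult_left_mono powr_mono2) auto
  also have "\<dots> = 2 powr t * (C * (y - x) powr t)" by (simp only: powr_mult mult_ac)
  also have "\<dots> \<le> 2 * (C * (y - x) powr t)"
    using powr_mono[of t 1 2] t C by (intro mult_right_mono) auto
  finally show ?thesis by simp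
qed

section \<open>Orders of the error function and the Diophantine type\<close>

lemma order_term_less_imp:
  assumes "0 < p" "p < 1" "n \<ge> 1" "v > 0" "ln (real n) / (- ln p) < v"
  shows "p < real n powr (- 1 / v)"
proof -
  have "0 < - ln p" using assms by simp
  from assms(5)[unfolded pos_divide_less_eq[OF this]] have "ln (real n) < v * (- ln p)" .
  then have "ln p < - 1 / v * ln (real n)" using assms(4) by (simp add: field_simps)
  also have "\<dots> = ln (real n powr (- 1 / v))" using assms(3) by (simp add: ln_powr)
  finally show ?thesis using assms by (subst (asm) ln_less_cancel_iff) auto
qed

lemma order_term_greater_imp:
  assumes "0 < p" "p < 1" "n \<ge> 1" "v > 0" "v < ln (real n) / (- ln p)"
  shows "real n powr (- 1 / v) < p"
proof -
  have "0 < - ln p" using assms by simp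
  from assms(5)[unfolded pos_less_divide_eq[OF this]] have "v * (- ln p) < ln (real n)" .
  then have "- 1 / v * ln (real n) < ln p" using assms(4) by (simp add: field_simps)
  then have "ln (real n powr (- 1 / v)) < ln p" using assms(3) by (simp add: ln_powr)
  then show ?thesis using assms by (subst (asm) ln_less_cancel_iff) auto
qed

text \<open>
  The factor \<open>1 / 2\<close>, needed for bumps of radius \<open>\<phi>(n) / 2\<close>, is paid for by lowering \<open>w\<close> to \<open>v\<close>.
\<close>

lemma eventually_order_term_half:
  fixes \<phi> :: "nat \<Rightarrow> real"
  assumes pos: "\<forall>n\<ge>1. 0 < \<phi> n" and lim: "\<phi> \<longlonglongrightarrow> 0" and v: "0 < v" "v < w"
  shows "\<forall>\<^sub>F n in sequentially. w < ln (real n) / (- ln (\<phi> n)) \<longrightarrow> real n powr (- 1 / v) \<le> \<phi> n / 2"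
proof -
  have "1 / w < 1 / v" using v by (simp add: frac_less2)
  then have "((\<lambda>n. real n powr (- (1 / v - 1 / w))) \<longlongrightarrow> 0) sequentially"
    by (intro tendsto_neg_powr filterlim_real_sequentially) auto
  then have "\<forall>\<^sub>F n in sequentially. real n powr (- (1 / v - 1 / w)) < 1 / 2"
    by (rule order_tendstoD) simp
  moreover have "\<forall>\<^sub>F n in sequentially. \<phi> n < 1"
    using lim by (rule order_tendstoD) simp
  moreover have "\<forall>\<^sub>F n in sequentially. (1::nat) \<le> n" by (rule eventually_ge_at_top)
  ultimately show ?thesis
  proof eventually_elim
    case (elim n)
    show ?case
    proof
      assume "w < ln (real n) / (- ln (\<phi> n))"
      then have "real n powr (- 1 / w) < \<phi> n"
        using elim pos v by (intro order_term_greater_imp) auto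
      then have "real n powr (- 1 / w) * real n powr (- (1 / v - 1 / w)) \<le> \<phi> n * (1 / 2)"
        using elim pos by (intro mult_mono) (auto intro: less_imp_le)
      also have "real n powr (- 1 / w) * real n powr (- (1 / v - 1 / w)) = real n powr (- 1 / v)"
        by (simp add: powr_add[symmetric])
      finally show "real n powr (- 1 / v) \<le> \<phi> n / 2" by simp
    qed
  qed
qed

lemma lower_order_nonneg:
  assumes pos: "\<forall>n\<ge>1. 0 < \<phi> n" and lim: "\<phi> \<longlonglongrightarrow> 0"
  shows "0 \<le> lower_order \<phi>"
  unfolding lower_order_def
proof (rule Liminf_bounded)
  have "\<forall>\<^sub>F n in sequentially. \<phi> n < 1" using lim by (rule order_tendstoD) simp
  moreover have "\<forall>\<^sub>F n in sequentially. (1::nat) \<le> n" by (rule eventually_ge_at_top)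
  ultimately show "\<forall>\<^sub>F n in sequentially. 0 \<le> ereal (ln (real n) / (- ln (\<phi> n)))"
  proof eventually_elim
    case (elim n)
    have "ln (\<phi> n) \<le> 0" using elim pos by simp
    then show ?case using elim by (simp add: divide_nonneg_nonpos)
  qed
qed

lemma lower_order_le_upper_order: "lower_order \<phi> \<le> upper_order \<phi>"
  unfolding lower_order_def upper_order_def by (rule Liminf_le_Limsup) simp

lemma eventually_of_less_lower_order:
  assumes pos: "\<forall>n\<ge>1. 0 < \<phi> n" and lim: "\<phi> \<longlonglongrightarrow> 0" and v: "0 < v" "ereal v < lower_order \<phi>"
  shows "\<forall>\<^sub>F n in sequentially. real n powr (- 1 / v) \<le> \<phi> n / 2"
proof -
  obtain w where w: "ereal v < ereal w" "ereal w < lower_order \<phi>"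
    using ereal_dense2[OF v(2)] by blast
  have "\<forall>\<^sub>F n in sequentially. ereal w < ereal (ln (real n) / (- ln (\<phi> n)))"
    using w(2) unfolding lower_order_def by (rule less_LiminfD)
  moreover have "\<forall>\<^sub>F n in sequentially. w < ln (real n) / (- ln (\<phi> n)) \<longrightarrow> real n powr (- 1 / v) \<le> \<phi> n / 2"
    using w v by (intro eventually_order_term_half pos lim) auto
  ultimately show ?thesis by eventually_elim simp
qed

lemma frequently_of_less_upper_order:
  assumes pos: "\<forall>n\<ge>1. 0 < \<phi> n" and lim: "\<phi> \<longlonglongrightarrow> 0" and v: "0 < v" "ereal v < upper_order \<phi>"
  shows "\<exists>\<^sub>F n in sequentially. real n powr (- 1 / v) \<le> \<phi> n / 2"
proof -
  obtain w where w: "ereal v < ereal w" "ereal w < upper_order \<phi>"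
    using ereal_dense2[OF v(2)] by blast
  have "\<exists>\<^sub>F n in sequentially. w < ln (real n) / (- ln (\<phi> n))"
  proof (rule ccontr)
    assume "\<not> ?thesis"
    then have "\<forall>\<^sub>F n in sequentially. ereal (ln (real n) / (- ln (\<phi> n))) \<le> ereal w"
      by (simp add: not_frequently not_less)
    then have "upper_order \<phi> \<le> ereal w" unfolding upper_order_def by (rule Limsup_bounded)
    with w(2) show False by simp
  qed
  moreover have "\<forall>\<^sub>F n in sequentially. w < ln (real n) / (- ln (\<phi> n)) \<longrightarrow> real n powr (- 1 / v) \<le> \<phi> n / 2"
    using w v by (intro eventually_order_term_half pos lim) auto
  ultimately show ?thesis by (rule frequently_rev_mp)
qed

lemma dist_int_lower_bound_of_type:
  assumes irr: "\<alpha> \<notin> \<rat>" and b: "diophantine_type \<alpha> < ereal b"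
  obtains c where "c > 0" "\<And>n. n \<ge> 1 \<Longrightarrow> c \<le> real n powr b * dist_int (real n * \<alpha>)"
proof -
  let ?X = "\<lambda>n. real n powr b * dist_int (real n * \<alpha>)"
  have "1 \<le> diophantine_type \<alpha>" unfolding diophantine_type_def by (intro Sup_upper) simp
  then have "ereal 1 < ereal b" using b by (metis le_less_trans one_ereal_def)
  then have b1: "1 \<le> b" by simp
  have "liminf (\<lambda>n. ereal (?X n)) \<noteq> 0"
  proof
    assume "liminf (\<lambda>n. ereal (?X n)) = 0"
    then have "ereal b \<le> diophantine_type \<alpha>"
      unfolding diophantine_type_def using b1 by (intro Sup_upper) auto
    with b show False by simp
  qed
  moreover have "0 \<le> liminf (\<lambda>n. ereal (?X n))"
    by (intro Liminf_bounded always_eventually) (simp add: dist_int_nonneg)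
  ultimately have "0 < liminf (\<lambda>n. ereal (?X n))" by simp
  then obtain e where e: "0 < ereal e" "ereal e < liminf (\<lambda>n. ereal (?X n))"
    using ereal_dense2 by blast
  from less_LiminfD[OF e(2)] obtain M where M: "\<And>n. n \<ge> M \<Longrightarrow> e < ?X n"
    by (auto simp: eventually_sequentially)
  define c where "c = Min (insert e (?X ` {1..M}))"
  have "c > 0" unfolding c_def using e(1) irr dist_int_pos_irrational
    by (subst Min_gr_iff) auto
  moreover have "c \<le> ?X n" if "n \<ge> 1" for n
  proof (cases "n \<le> M")
    case True
    then show ?thesis unfolding c_def using that by (intro Min_le) auto
  next
    case False
    have "c \<le> e" unfolding c_def by (intro Min_le) auto
    with M[of n] False show ?thesis by simp
  qed
  ultimately show ?thesis by (rule that)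
qed

section \<open>The dimension of the set of approximable points\<close>

lemma hausdorff_measure_inhom_null:
  assumes pos: "\<forall>n\<ge>1. 0 < \<phi> n"
    and dec: "\<forall>m n. 1 \<le> m \<and> m \<le> n \<longrightarrow> \<phi> n \<le> \<phi> m" and lim: "\<phi> \<longlonglongrightarrow> 0"
    and s: "upper_order \<phi> < ereal s"
  shows "hausdorff_measure s (inhom_approx_set \<phi> \<alpha>) = 0"
proof -
  obtain v where v: "upper_order \<phi> < ereal v" "ereal v < ereal s"
    using ereal_dense2[OF s] by blast
  have "0 \<le> upper_order \<phi>"
    using lower_order_nonneg[OF pos lim] lower_order_le_upper_order by (rule order_trans)
  then have v0: "0 < v" using v(1) by (metis ereal_less(2) le_less_trans)
  have vs: "v < s" using v(2) by simp
  \<comment> \<open>Nothing is known about \<open>\<phi> 0\<close>, which may be negative.\<close>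
  define \<rho> where "\<rho> n = (if n = 0 then 0 else \<phi> n)" for n
  have \<rho>0: "0 \<le> \<rho> n" for n using pos by (simp add: \<rho>_def Suc_le_eq less_imp_le)
  have ev\<rho>: "\<forall>\<^sub>F n in sequentially. \<rho> n = \<phi> n"
    using eventually_ge_at_top[of 1] by eventually_elim (simp add: \<rho>_def)
  have \<rho>lim: "\<rho> \<longlonglongrightarrow> 0" using lim tendsto_cong[OF ev\<rho>] by simp
  have "\<forall>\<^sub>F n in sequentially. ereal (ln (real n) / (- ln (\<phi> n))) < ereal v"
    using v(1) unfolding upper_order_def by (rule Limsup_lessD)
  moreover have "\<forall>\<^sub>F n in sequentially. \<phi> n < 1" using lim by (rule order_tendstoD) simp
  ultimately have "\<forall>\<^sub>F n in sequentially. norm (\<rho> n powr s) \<le> real n powr (- (s / v))"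
    using ev\<rho> eventually_ge_at_top[of 1]
  proof eventually_elim
    case (elim n)
    have "\<phi> n < real n powr (- 1 / v)" using elim pos v0 by (intro order_term_less_imp) auto
    then have "\<phi> n powr s \<le> (real n powr (- 1 / v)) powr s"
      using pos elim v0 vs by (intro powr_mono2) (auto intro: less_imp_le)
    also have "\<dots> = real n powr (- (s / v))" by (simp add: powr_powr)
    finally show ?case using elim by simp
  qed
  then have sum: "summable (\<lambda>n. \<rho> n powr s)"
    by (rule summable_comparison_test_ev) (use v0 vs in \<open>simp add: summable_real_powr_iff\<close>)
  define E where "E j = {y. infinite {n. \<bar>frac (real n * \<alpha>) + of_int j - y\<bar> < \<rho> n}}" for j :: int
  have null: "hausdorff_measure s (E j) = 0" for j
    unfolding E_def using v0 vs by (intro hausdorff_measure_limsup_balls \<rho>0 \<rho>lim sum) auto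
  have "inhom_approx_set \<phi> \<alpha> \<subseteq> (\<Union>k. E (int_decode k))"
  proof
    fix y assume "y \<in> inhom_approx_set \<phi> \<alpha>"
    then have inf: "infinite {n. 1 \<le> n \<and> dist_int (real n * \<alpha> - y) < \<phi> n}" (is "infinite ?S")
      by (simp add: inhom_approx_set_def)
    have "\<exists>m :: int. dist_int (real n * \<alpha> - y) = \<bar>real n * \<alpha> - y - of_int m\<bar>" for n
      using dist_int_nearest by metis
    then obtain m :: "nat \<Rightarrow> int" where
      m: "\<And>n. dist_int (real n * \<alpha> - y) = \<bar>real n * \<alpha> - y - of_int (m n)\<bar>" by metis
    define j where "j n = \<lfloor>real n * \<alpha>\<rfloor> - m n" for n
    have j: "dist_int (real n * \<alpha> - y) = \<bar>frac (real n * \<alpha>) + of_int (j n) - y\<bar>" for n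
      unfolding m by (simp add: j_def frac_def algebra_simps)
    \<comment> \<open>The integer parts \<open>j n\<close> are bounded, so one of them occurs infinitely often.\<close>
    define B where "B = \<lceil>\<bar>y\<bar> + 1 + \<phi> 1\<rceil>"
    have "j ` ?S \<subseteq> {-B..B}"
    proof
      fix z assume "z \<in> j ` ?S"
      then obtain n where n: "n \<in> ?S" "z = j n" by blast
      have "\<phi> n \<le> \<phi> 1" using dec n(1) by simp
      then have "\<bar>frac (real n * \<alpha>) + of_int z - y\<bar> < \<phi> 1" using n j[of n] by auto
      then have "\<bar>real_of_int z\<bar> \<le> \<bar>y\<bar> + 1 + \<phi> 1"
        using frac_ge_0[of "real n * \<alpha>"] frac_lt_1[of "real n * \<alpha>"] by linarith
      then show "z \<in> {-B..B}" unfolding B_def by (auto simp: abs_le_iff) linarith+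
    qed
    then have "finite (j ` ?S)" by (rule finite_subset) simp
    from pigeonhole_infinite[OF inf this] obtain n0 where
      n0: "infinite {n \<in> ?S. j n = j n0}" by blast
    have "y \<in> E (j n0)"
      unfolding E_def mem_Collect_eq
      by (rule infinite_super[OF _ n0]) (auto simp: j \<rho>_def)
    then have "y \<in> E (int_decode (int_encode (j n0)))" by simp
    then show "y \<in> (\<Union>k. E (int_decode k))" by blast
  qed
  moreover have "hausdorff_measure s (\<Union>k. E (int_decode k)) = 0"
    by (intro hausdorff_measure_UN_null null)
  ultimately show ?thesis by (rule hausdorff_measure_mono_null[rotated])
qed

text \<open>
  If the conditions of \<open>visits_le_powr\<close> hold with \<open>r = \<phi>(N) / 2\<close> for infinitely many \<open>N\<close>, the orbit
  densities satisfy the hypotheses of \<open>hausdorff_dim_limsup_densities\<close>. The exceptional set \<open>D\<close>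
  consists of the points \<open>n \<alpha> + m\<close>: another point that is within \<open>\<phi>(N)\<close> of some \<open>n \<alpha>\<close> modulo 1 with
  \<open>n \<le> N\<close>, for infinitely many \<open>N\<close>, is so for infinitely many distinct \<open>n\<close>.
\<close>

lemma hausdorff_dim_inhom_ge:
  assumes irr: "\<alpha> \<notin> \<rat>" and pos: "\<forall>n\<ge>1. 0 < \<phi> n"
    and dec: "\<forall>m n. 1 \<le> m \<and> m \<le> n \<longrightarrow> \<phi> n \<le> \<phi> m" and lim: "\<phi> \<longlonglongrightarrow> 0"
    and s: "0 < s" and st: "s < t" and t1: "t \<le> 1" and C: "C \<ge> 0"
    and freq: "\<exists>\<^sub>F N in sequentially. \<exists>q. best_denominator \<alpha> q \<and> q \<le> N \<and>
        (\<forall>d\<in>{1..N}. dist_int (real q * \<alpha>) \<le> dist_int (real d * \<alpha>)) \<and>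
        1 \<le> real N * (\<phi> N / 2) powr t \<and>
        (1 / real q \<le> (\<phi> N / 2) powr t \<or>
         1 / dist_int (real q * \<alpha>) \<le> C * real N * real q powr (1 / t - 1))"
  shows "ereal s \<le> hausdorff_dim (inhom_approx_set \<phi> \<alpha>)"
proof -
  define G where "G = {N. \<exists>q. best_denominator \<alpha> q \<and> q \<le> N \<and>
        (\<forall>d\<in>{1..N}. dist_int (real q * \<alpha>) \<le> dist_int (real d * \<alpha>)) \<and>
        1 \<le> real N * (\<phi> N / 2) powr t \<and>
        (1 / real q \<le> (\<phi> N / 2) powr t \<or>
         1 / dist_int (real q * \<alpha>) \<le> C * real N * real q powr (1 / t - 1))}"
  have "infinite G" using freq unfolding G_def by (simp add: frequently_sequentially infinite_nat_iff_unbounded_le)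
  then obtain f :: "nat \<Rightarrow> nat" where f: "strict_mono f" "\<And>i. f i \<in> G"
    using infinite_enumerate by blast
  define r where "r i = \<phi> (f i) / 2" for i
  have f1: "1 \<le> f i" for i using f(2)[of i] by (auto simp: G_def best_denominator_def)
  have r0: "r i > 0" for i using pos f1 by (simp add: r_def)
  have flim: "filterlim f at_top sequentially" using f(1) by (rule filterlim_subseq)
  have \<phi>f: "(\<lambda>i. \<phi> (f i)) \<longlonglongrightarrow> 0" using lim flim by (rule filterlim_compose)
  have rlim: "r \<longlonglongrightarrow> 0" using tendsto_divide[OF \<phi>f tendsto_const[of 2]] by (simp add: r_def[abs_def])
  define A where "A i = (\<Union>n\<in>{1..f i}. {frac (real n * \<alpha>) - r i..frac (real n * \<alpha>) + r i})" for i
  define D where "D = (\<lambda>(n :: nat, m :: int). real n * \<alpha> + of_int m) ` UNIV"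
  show ?thesis
  proof (rule hausdorff_dim_limsup_densities[where h = "\<lambda>i. orbit_density \<alpha> (f i) (r i)" and A = A
        and D = D and C = "2 * (10 + 2 * C)" and t = t])
    show "continuous_on {0..1} (orbit_density \<alpha> (f i) (r i))" for i
      by (rule continuous_on_orbit_density)
    show "0 \<le> orbit_density \<alpha> (f i) (r i) x" for i x by (rule orbit_density_nonneg[OF r0])
    show "\<forall>\<^sub>F i in sequentially. \<forall>x\<in>{0..1}. \<bar>integral {0..x} (orbit_density \<alpha> (f i) (r i)) - x\<bar> \<le> \<epsilon>"
      if \<epsilon>: "\<epsilon> > 0" for \<epsilon>
    proof -
      have "\<forall>\<^sub>F i in sequentially. \<forall>r. 0 < r \<longrightarrow> r \<le> 1/8 \<longrightarrow> r \<le> \<epsilon> / 8 \<longrightarrow>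
        (\<forall>x\<in>{0..1}. \<bar>integral {0..x} (orbit_density \<alpha> (f i) r) - x\<bar> \<le> \<epsilon>)"
        using eventually_compose_filterlim[OF orbit_density_equidistributed[OF irr \<epsilon>] flim] .
      moreover have "\<forall>\<^sub>F i in sequentially. r i < 1/8" "\<forall>\<^sub>F i in sequentially. r i < \<epsilon> / 8"
        by (rule order_tendstoD(2)[OF rlim], use \<epsilon> in simp)+
      ultimately show ?thesis by eventually_elim (use r0 in auto)
    qed
    show "integral {x..y} (orbit_density \<alpha> (f i) (r i)) \<le> 2 * (10 + 2 * C) * (y - x) powr t"
      if "0 \<le> x" "x \<le> y" "y \<le> 1" for i x y
    proof (rule orbit_density_hoelder[OF r0 f1])
      fix c \<rho> assume \<rho>: "r i \<le> \<rho>"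
      obtain q where "best_denominator \<alpha> q" "q \<le> f i"
        "\<And>d. d \<in> {1..f i} \<Longrightarrow> dist_int (real q * \<alpha>) \<le> dist_int (real d * \<alpha>)"
        "1 \<le> real (f i) * r i powr t"
        "1 / real q \<le> r i powr t \<or>
         1 / dist_int (real q * \<alpha>) \<le> C * real (f i) * real q powr (1 / t - 1)"
        using f(2)[of i] unfolding G_def r_def by blast
      then show "real (visits \<alpha> (f i) c \<rho>) \<le> (10 + 2 * C) * real (f i) * \<rho> powr t"
        using s st t1 r0[of i] C \<rho> by (intro visits_le_powr[OF irr]) auto
    qed (use s st t1 C that in auto)
    show "closed (A i)" for i unfolding A_def by (intro closed_UN) auto
    show "orbit_density \<alpha> (f i) (r i) x = 0" if "x \<notin> A i" for i x
    proof -
      have "bump (r i) (x - frac (real n * \<alpha>)) = 0" if "n \<in> {1..f i}" for n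
        using \<open>x \<notin> A i\<close> that by (intro bump_eq_0 r0) (force simp: A_def)
      then show ?thesis by (simp add: orbit_density_def)
    qed
    show "countable D" by (simp add: D_def)
    show "y \<in> inhom_approx_set \<phi> \<alpha>" if y: "infinite {i. y \<in> A i}" "y \<notin> D" for y
    proof (rule ccontr)
      define S where "S = {n. 1 \<le> n \<and> dist_int (real n * \<alpha> - y) < \<phi> n}"
      assume "y \<notin> inhom_approx_set \<phi> \<alpha>"
      then have finS: "finite S" by (simp add: inhom_approx_set_def S_def)
      have nz: "0 < dist_int (real n * \<alpha> - y)" for n
      proof (rule ccontr)
        assume "\<not> ?thesis"
        then have "dist_int (real n * \<alpha> - y) = 0" using dist_int_nonneg[of "real n * \<alpha> - y"] by simp
        then obtain m :: int where "real n * \<alpha> - y = of_int m"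
          using dist_int_nearest[of "real n * \<alpha> - y"] by fastforce
        then have "y = real n * \<alpha> + of_int (- m)" by simp
        then have "y \<in> D" unfolding D_def by (intro image_eqI[of _ _ "(n, - m)"]) simp_all
        with y(2) show False by simp
      qed
      \<comment> \<open>If only finitely many \<open>n\<close> were solutions, their distances to \<open>y\<close> would stay above \<open>\<delta>\<close>, while
         the radii \<open>\<phi> (f i)\<close> tend to 0.\<close>
      define \<delta> where "\<delta> = Min (insert 1 ((\<lambda>n. dist_int (real n * \<alpha> - y)) ` S))"
      have "\<delta> > 0" using finS nz by (simp add: \<delta>_def)
      then have "\<forall>\<^sub>F i in sequentially. \<phi> (f i) < \<delta>" using \<phi>f by (intro order_tendstoD)
      then obtain M where M: "\<And>i. i \<ge> M \<Longrightarrow> \<phi> (f i) < \<delta>" by (auto simp: eventually_sequentially)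
      obtain i where i: "i \<ge> M" "y \<in> A i"
        using y(1) unfolding infinite_nat_iff_unbounded_le by blast
      then obtain n where n: "n \<in> {1..f i}" "\<bar>y - frac (real n * \<alpha>)\<bar> \<le> r i"
        by (auto simp: A_def abs_le_iff)
      have "dist_int (real n * \<alpha> - y) \<le> r i"
        using dist_int_le_frac[of y "real n * \<alpha>"] n(2) dist_int_minus[of "y - real n * \<alpha>"] by simp
      also have "r i < \<phi> (f i)" using r0[of i] by (simp add: r_def)
      finally have less: "dist_int (real n * \<alpha> - y) < \<phi> (f i)" .
      also have "\<phi> (f i) \<le> \<phi> n" using dec n(1) by simp
      finally have "n \<in> S" using n(1) by (simp add: S_def)
      then have "\<delta> \<le> dist_int (real n * \<alpha> - y)" unfolding \<delta>_def using finS by (intro Min_le) auto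
      with less M[OF i(1)] show False by simp
    qed
  qed (use s st t1 C in auto)
qed

text \<open>
  Below the lower order, \<open>\<phi>(N)\<close> is large for all \<open>N\<close>, so \<open>N\<close> may be chosen among the best
  denominators.
\<close>

lemma hausdorff_dim_inhom_ge_lower:
  assumes irr: "\<alpha> \<notin> \<rat>" and pos: "\<forall>n\<ge>1. 0 < \<phi> n"
    and dec: "\<forall>m n. 1 \<le> m \<and> m \<le> n \<longrightarrow> \<phi> n \<le> \<phi> m" and lim: "\<phi> \<longlonglongrightarrow> 0"
    and s: "0 < s" "s < t" and t1: "t \<le> 1" and tl: "ereal t < lower_order \<phi>"
  shows "ereal s \<le> hausdorff_dim (inhom_approx_set \<phi> \<alpha>)"
proof (rule hausdorff_dim_inhom_ge[OF irr pos dec lim s t1, where C = 0])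
  have t0: "t > 0" using s by simp
  have best: "\<exists>\<^sub>F N in sequentially. best_denominator \<alpha> N"
    unfolding frequently_sequentially using infinitely_many_best_denominators[OF irr] by metis
  have ev: "\<forall>\<^sub>F N in sequentially. real N powr (- 1 / t) \<le> \<phi> N / 2"
    by (rule eventually_of_less_lower_order[OF pos lim t0 tl])
  show "\<exists>\<^sub>F N in sequentially. \<exists>q. best_denominator \<alpha> q \<and> q \<le> N \<and>
        (\<forall>d\<in>{1..N}. dist_int (real q * \<alpha>) \<le> dist_int (real d * \<alpha>)) \<and>
        1 \<le> real N * (\<phi> N / 2) powr t \<and>
        (1 / real q \<le> (\<phi> N / 2) powr t \<or>
         1 / dist_int (real q * \<alpha>) \<le> 0 * real N * real q powr (1 / t - 1))"
  proof (rule frequently_rev_mp[OF best], rule eventually_mono[OF ev], rule impI)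
    fix N assume le: "real N powr (- 1 / t) \<le> \<phi> N / 2" and N: "best_denominator \<alpha> N"
    have N0: "real N > 0" using N by (simp add: best_denominator_def)
    have "1 / real N = real N powr (- 1 / t * t)"
      using N0 t0 by (simp add: powr_minus_divide)
    also have "\<dots> = (real N powr (- 1 / t)) powr t" by (simp only: powr_powr)
    also have "\<dots> \<le> (\<phi> N / 2) powr t" using le t0 by (intro powr_mono2) auto
    finally have "1 / real N \<le> (\<phi> N / 2) powr t" .
    moreover from this have "1 \<le> real N * (\<phi> N / 2) powr t" using N0 by (simp add: field_simps)
    ultimately show "\<exists>q. best_denominator \<alpha> q \<and> q \<le> N \<and>
        (\<forall>d\<in>{1..N}. dist_int (real q * \<alpha>) \<le> dist_int (real d * \<alpha>)) \<and>
        1 \<le> real N * (\<phi> N / 2) powr t \<and>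
        (1 / real q \<le> (\<phi> N / 2) powr t \<or>
         1 / dist_int (real q * \<alpha>) \<le> 0 * real N * real q powr (1 / t - 1))"
      using N by (intro exI[of _ N]) (auto simp: best_denominator_def)
  qed
qed simp

text \<open>
  Below the upper order, \<open>\<phi>(N)\<close> is large only for certain \<open>N\<close>, unrelated to the best denominators.
  For those with \<open>r = \<phi>(N) / 2 \<ge> N\<^bsup>-1/v\<^esup>\<close> and for the best denominator \<open>q\<close> up to \<open>N\<close>, if
  \<open>1 / q > r\<^sup>t\<close> then \<open>N\<close> is at least \<open>q\<^bsup>v/t\<^esup>\<close>, and the condition \<open>t (1 + b) \<le> 1 + v\<close> is
  what the inequality \<open>q\<^sup>b \<le> N q\<^bsup>1/t - 1\<^esup>\<close> requires.
\<close>

lemma hausdorff_dim_inhom_ge_type: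
  assumes irr: "\<alpha> \<notin> \<rat>" and pos: "\<forall>n\<ge>1. 0 < \<phi> n"
    and dec: "\<forall>m n. 1 \<le> m \<and> m \<le> n \<longrightarrow> \<phi> n \<le> \<phi> m" and lim: "\<phi> \<longlonglongrightarrow> 0"
    and s: "0 < s" "s < t" and t1: "t \<le> 1"
    and v: "ereal v < upper_order \<phi>" "t \<le> v"
    and b: "diophantine_type \<alpha> < ereal b" "t * (1 + b) \<le> 1 + v"
  shows "ereal s \<le> hausdorff_dim (inhom_approx_set \<phi> \<alpha>)"
proof -
  have t0: "t > 0" and v0: "v > 0" using s v by auto
  obtain c where c: "c > 0" "\<And>n. n \<ge> 1 \<Longrightarrow> c \<le> real n powr b * dist_int (real n * \<alpha>)"
    using dist_int_lower_bound_of_type[OF irr b(1)] by metis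
  have freq: "\<exists>\<^sub>F N in sequentially. real N powr (- 1 / v) \<le> \<phi> N / 2"
    by (rule frequently_of_less_upper_order[OF pos lim v0 v(1)])
  show ?thesis
  proof (rule hausdorff_dim_inhom_ge[OF irr pos dec lim s t1, where C = "1 / c"])
    show "\<exists>\<^sub>F N in sequentially. \<exists>q. best_denominator \<alpha> q \<and> q \<le> N \<and>
        (\<forall>d\<in>{1..N}. dist_int (real q * \<alpha>) \<le> dist_int (real d * \<alpha>)) \<and>
        1 \<le> real N * (\<phi> N / 2) powr t \<and>
        (1 / real q \<le> (\<phi> N / 2) powr t \<or>
         1 / dist_int (real q * \<alpha>) \<le> 1 / c * real N * real q powr (1 / t - 1))"
    proof (rule frequently_rev_mp[OF freq], rule eventually_mono[OF eventually_ge_at_top[of 1]], rule impI)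
      fix N :: nat assume N: "1 \<le> N" and le: "real N powr (- 1 / v) \<le> \<phi> N / 2"
      obtain q where q: "q \<in> {1..N}" "best_denominator \<alpha> q"
        "\<And>d. d \<in> {1..N} \<Longrightarrow> dist_int (real q * \<alpha>) \<le> dist_int (real d * \<alpha>)"
        using best_denominator_up_to[OF N] by metis
      have q1: "real q \<ge> 1" using q(1) by simp
      have "real N powr (- (t / v)) = (real N powr (- 1 / v)) powr t" by (simp add: powr_powr)
      also have "\<dots> \<le> (\<phi> N / 2) powr t" using le t0 by (intro powr_mono2) auto
      finally have r: "real N powr (- (t / v)) \<le> (\<phi> N / 2) powr t" .
      have "1 \<le> real N powr (1 - t / v)"
        using N v(2) v0 by (intro ge_one_powr_ge_zero) auto
      also have "\<dots> = real N * real N powr (- (t / v))" using N by (simp add: powr_diff powr_minus_divide)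
      also have "\<dots> \<le> real N * (\<phi> N / 2) powr t" by (intro mult_left_mono r) simp
      finally have "1 \<le> real N * (\<phi> N / 2) powr t" .
      moreover have "1 / dist_int (real q * \<alpha>) \<le> 1 / c * real N * real q powr (1 / t - 1)"
        if "\<not> 1 / real q \<le> (\<phi> N / 2) powr t"
      proof -
        have "real N powr (- (t / v)) \<le> 1 / real q" using r that by linarith
        then have "real q \<le> real N powr (t / v)" using N q1 by (simp add: powr_minus field_simps)
        then have "real q powr (v / t) \<le> (real N powr (t / v)) powr (v / t)"
          using t0 v0 by (intro powr_mono2) auto
        also have "\<dots> = real N" using t0 v0 N by (simp add: powr_powr)
        finally have qN: "real q powr (v / t) \<le> real N" .
        have "b \<le> v / t + (1 / t - 1)" using b(2) t0 by (simp add: field_simps)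
        then have "real q powr b \<le> real q powr (v / t) * real q powr (1 / t - 1)"
          unfolding powr_add[symmetric] using q1 by (rule powr_mono)
        also have "\<dots> \<le> real N * real q powr (1 / t - 1)" using qN by (intro mult_right_mono) auto
        finally have "real q powr b \<le> real N * real q powr (1 / t - 1)" .
        then have "real q powr b / c \<le> real N * real q powr (1 / t - 1) / c"
          using c(1) by (intro divide_right_mono) auto
        moreover have "1 / dist_int (real q * \<alpha>) \<le> real q powr b / c"
        proof -
          have "dist_int (real q * \<alpha>) > 0" using irr q(1) by (intro dist_int_pos_irrational) auto
          then show ?thesis using c(1) c(2)[of q] q(1) by (simp add: field_simps)
        qed
        ultimately show ?thesis by simp
      qed
      ultimately show "\<exists>q. best_denominator \<alpha> q \<and> q \<le> N \<and>
        (\<forall>d\<in>{1..N}. dist_int (real q * \<alpha>) \<le> dist_int (real d * \<alpha>)) \<and>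
        1 \<le> real N * (\<phi> N / 2) powr t \<and>
        (1 / real q \<le> (\<phi> N / 2) powr t \<or>
         1 / dist_int (real q * \<alpha>) \<le> 1 / c * real N * real q powr (1 / t - 1))"
        using q by (intro exI[of _ q]) auto
    qed
  qed (use c in auto)
qed

theorem theorem1p2:
  fixes \<alpha> :: real and \<beta> :: ereal and \<phi> :: "nat \<Rightarrow> real"
  assumes "\<alpha> \<notin> \<rat>"
    and "\<beta> = diophantine_type \<alpha>"
    and "\<forall>n\<ge>1. 0 < \<phi> n"
    and "\<forall>m n. 1 \<le> m \<and> m \<le> n \<longrightarrow> \<phi> n \<le> \<phi> m"
    and "\<phi> \<longlonglongrightarrow> 0"
  shows "min 1 (min (upper_order \<phi>) (max (lower_order \<phi>) ((1 + upper_order \<phi>) / (1 + \<beta>))))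
           \<le> hausdorff_dim (inhom_approx_set \<phi> \<alpha>)
       \<and> hausdorff_dim (inhom_approx_set \<phi> \<alpha>) \<le> upper_order \<phi>"
proof
  note irr = assms(1) and pos = assms(3) and dec = assms(4) and lim = assms(5)
  let ?E = "inhom_approx_set \<phi> \<alpha>" and ?u = "upper_order \<phi>" and ?l = "lower_order \<phi>"
  have u0: "0 \<le> ?u"
    using lower_order_nonneg[OF pos lim] lower_order_le_upper_order by (rule order_trans)
  have dim0: "0 \<le> hausdorff_dim ?E"
    unfolding hausdorff_dim_def by (intro Inf_greatest) auto
  show "hausdorff_dim ?E \<le> ?u"
  proof (rule ccontr)
    assume "\<not> ?thesis"
    then obtain s where s: "?u < ereal s" "ereal s < hausdorff_dim ?E"
      using ereal_dense2[of ?u "hausdorff_dim ?E"] by (auto simp: not_le)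
    have "0 \<le> s" using u0 s(1) by (metis ereal_less_eq(5) less_imp_le order_trans)
    then have "hausdorff_dim ?E \<le> ereal s"
      by (rule hausdorff_dim_leI) (rule hausdorff_measure_inhom_null[OF pos dec lim s(1)])
    with s(2) show False by simp
  qed
  show "min 1 (min ?u (max ?l ((1 + ?u) / (1 + \<beta>)))) \<le> hausdorff_dim ?E"
  proof (rule ccontr)
    assume "\<not> ?thesis"
    then have "hausdorff_dim ?E < min 1 (min ?u (max ?l ((1 + ?u) / (1 + \<beta>))))" by (simp only: not_le)
    then obtain s where s: "hausdorff_dim ?E < ereal s"
      "ereal s < min 1 (min ?u (max ?l ((1 + ?u) / (1 + \<beta>))))"
      using ereal_dense2 by blast
    obtain t where t: "ereal s < ereal t" "ereal t < min 1 (min ?u (max ?l ((1 + ?u) / (1 + \<beta>))))"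
      using ereal_dense2[OF s(2)] by blast
    have s0: "0 < s" using dim0 s(1) by (metis ereal_less(2) le_less_trans)
    have st: "s < t" using t(1) by simp
    have t1: "t \<le> 1" and tu: "ereal t < ?u"
      using t(2) by (auto simp: one_ereal_def)
    have t0: "t > 0" using s0 st by simp
    consider "ereal t < ?l" | "ereal t < (1 + ?u) / (1 + \<beta>)" using t(2) by (auto simp: less_max_iff_disj)
    then have "ereal s \<le> hausdorff_dim ?E"
    proof cases
      case 1
      then show ?thesis by (rule hausdorff_dim_inhom_ge_lower[OF irr pos dec lim s0 st t1])
    next
      case 2
      have "1 \<le> \<beta>" unfolding assms(2) diophantine_type_def by (intro Sup_upper) simp
      then have "\<beta> \<noteq> - \<infinity>" by auto
      moreover have "\<beta> \<noteq> \<infinity>" using 2 t0 by auto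
      ultimately obtain b where b: "\<beta> = ereal b" by (cases \<beta>) auto
      have b1: "1 \<le> b" using \<open>1 \<le> \<beta>\<close> by (simp add: b one_ereal_def)
      \<comment> \<open>Any \<open>v\<close> between these two numbers leaves room for an exponent above \<open>b\<close>, namely
         \<open>(1 + v) / t - 1\<close>.\<close>
      have "ereal (max t (t * (1 + b) - 1)) < ?u"
      proof (cases ?u)
        case (real u)
        have "t < (1 + u) / (1 + b)" using 2 b1 by (simp add: real b one_ereal_def)
        then have "t * (1 + b) < 1 + u" using b1 by (simp add: less_divide_eq)
        then show ?thesis using tu by (simp add: real)
      next
        case PInf
        then show ?thesis by (simp add: max_def)
      next
        case MInf
        then show ?thesis using u0 by simp
      qed
      then obtain v where v: "ereal (max t (t * (1 + b) - 1)) < ereal v" "ereal v < ?u"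
        using ereal_dense2 by blast
      have "t * (1 + b) < 1 + v" using v(1) by simp
      then have "b < (1 + v) / t - 1" using t0 by (simp add: field_simps)
      then have type: "diophantine_type \<alpha> < ereal ((1 + v) / t - 1)"
        using b assms(2) by simp
      show ?thesis
        by (rule hausdorff_dim_inhom_ge_type[OF irr pos dec lim s0 st t1 v(2) _ type])
           (use v(1) t0 in auto)
    qed
    with s(1) show False by simp
  qed
qed

end
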